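(* An irreducible homogeneous cubic polynomial $F(x,y,z)$ over $\mathbb{C}$, with inhomogeneous version $f(p,q)=F(p,q,1)$, can be transformed under a linear change of variables to one of the following forms. 1. If $f(p,q)$ defines a singular variety $V$ in $\mathbb{C}P^2$, then it is equivalent to either (a) $p^3-q^2$, and then it has a one-dimensional symmetry group given by the matrices $$\begin{pmatrix}1&0&0\\0&\alpha&0\\0&0&\alpha^{-2}\end{pmatrix};$$ or (b) $p^2(p+1)-q^2$, which has a discrete symmetry group, consisting of $6$ projective symmetries which correspond to $18$ genuine symmetries. 2. If $f(p,q)$ defines a nonsingular variety $V$ in $\mathbb{C}P^2$, then it is equivalent either to (a) a cubic in the one-parameter family $p^3+ap+1-q^2$, and then it has $18$ projective symmetries; or (b) $p^3+p-q^2$, and in this case it has $36$ projective symmetries; or (c) $p^3+1-q^2$, and in this case it has $54$ projective symmetries. The cubic $p^3+q^3+1$ belongs to this class.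
   Context: A homogeneous cubic $F(x,y,z)$ is identified with its inhomogeneous version $f(p,q)=F(p,q,1)$ (so $F(x,y,z)=z^3f(x/z,y/z)$; e.g. $p^3-q^2$ stands for $x^3-y^2z$). $V$ denotes the set of zeros of $f$ in $\mathbb{C}P^2$, i.e. the projective curve $F=0$. Two homogeneous cubics $F,\bar F$ are equivalent if $\bar F(\mathbf{x})=F(A\mathbf{x})$ for some $A\in GL(3,\mathbb{C})$; equivalence of inhomogeneous versions means equivalence of the corresponding homogeneous cubics. The (genuine) symmetry group is $G_F=\{A\in GL(3,\mathbb{C}): F(A\mathbf{x})=F(\mathbf{x})\}$, with $A$ acting on column vectors $(x,y,z)^T$; symmetry groups of equivalent cubics are conjugate, and the matrices in 1(a) are written for the canonical form. The projective symmetry group is the image $\Gamma_f$ of $G_F$ in $PSL(3,\mathbb{C})=GL(3,\mathbb{C})/\{\lambda I\}$; its elements are the projective symmetries.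
   Formalization: In 1(a) the listed matrices give the projective group; the genuine group also contains their multiples by cube roots of unity (ωI is always a symmetry). In 2(a) a is nonzero, since a=0 is the cubic of 2(c), with 54 projective symmetries. *)

theory Defs
  imports
    "HOL-Analysis.Analysis"
    "HOL-Computational_Algebra.Computational_Algebra"
    "HOL-Algebra.Coset"
begin

section \<open>Ternary forms\<close>

text \<open>
  The ring \<open>\<complex>[x,y,z]\<close> is represented as \<^typ>\<open>complex poly poly poly\<close>: the outermost
  indeterminate is \<open>x\<close>, the middle one \<open>y\<close>, the innermost one \<open>z\<close>. Likewise \<open>\<complex>[p,q]\<close> is
  \<^typ>\<open>complex poly poly\<close> with \<open>p\<close> outermost.
\<close>

definition eval3 :: "complex poly poly poly \<Rightarrow> complex ^ 3 \<Rightarrow> complex" where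
  "eval3 F v = poly (poly (poly F [:[:v $ 1:]:]) [:v $ 2:]) (v $ 3)"

text \<open>The zero polynomial satisfies this predicate; it is excluded by irreducibility.\<close>

definition homogeneous_cubic :: "complex poly poly poly \<Rightarrow> bool" where
  "homogeneous_cubic F \<longleftrightarrow>
     (\<forall>i j k. coeff (coeff (coeff F i) j) k \<noteq> 0 \<longrightarrow> i + j + k = 3)"

definition deriv_x :: "complex poly poly poly \<Rightarrow> complex poly poly poly" where
  "deriv_x F = pderiv F"

definition deriv_y :: "complex poly poly poly \<Rightarrow> complex poly poly poly" where
  "deriv_y F = map_poly pderiv F"

definition deriv_z :: "complex poly poly poly \<Rightarrow> complex poly poly poly" where
  "deriv_z F = map_poly (map_poly pderiv) F"

text \<open>
  A point of \<open>\<complex>P\<^sup>2\<close> is given by a nonzero vector of homogeneous coordinates. For irreducible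
  \<open>F\<close>, which generates the ideal of the curve \<open>F = 0\<close>, this is singularity of that curve.
\<close>

definition singular_curve :: "complex poly poly poly \<Rightarrow> bool" where
  "singular_curve F \<longleftrightarrow>
     (\<exists>v. v \<noteq> 0 \<and> eval3 F v = 0 \<and>
          eval3 (deriv_x F) v = 0 \<and> eval3 (deriv_y F) v = 0 \<and> eval3 (deriv_z F) v = 0)"

section \<open>Inhomogeneous versions\<close>

definition p_var :: "complex poly poly" where
  "p_var = [:0, 1:]"

definition q_var :: "complex poly poly" where
  "q_var = [:[:0, 1:]:]"

definition cst :: "complex \<Rightarrow> complex poly poly" where
  "cst c = [:[:c:]:]"

text \<open>\<open>f(p,q) = F(p,q,1)\<close>\<close>

definition dehomogenize :: "complex poly poly poly \<Rightarrow> complex poly poly" where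
  "dehomogenize F = map_poly (map_poly (\<lambda>c. poly c 1)) F"

text \<open>
  \<open>F(x,y,z) = z\<^sup>3 f(x/z,y/z)\<close>, for \<open>f\<close> of total degree at most 3: the monomial \<open>p\<^sup>i q\<^sup>j\<close>
  becomes \<open>x\<^sup>i y\<^sup>j z\<close> to the power \<open>3 - i - j\<close>.
\<close>

definition homogenize :: "complex poly poly \<Rightarrow> complex poly poly poly" where
  "homogenize f =
     (\<Sum>i\<le>3. \<Sum>j\<le>3 - i. monom (monom (monom (coeff (coeff f i) j) (3 - i - j)) j) i)"

section \<open>Equivalence and symmetries\<close>

text \<open>
  Since \<open>\<complex>\<close> is infinite, equality of polynomial functions on \<open>\<complex>\<^sup>3\<close> is equality of polynomials.
\<close>

definition transforms_to ::
  "complex poly poly poly \<Rightarrow> complex ^ 3 ^ 3 \<Rightarrow> complex poly poly poly \<Rightarrow> bool" where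
  "transforms_to F A G \<longleftrightarrow> invertible A \<and> (\<forall>v. eval3 G v = eval3 F (A *v v))"

definition equivalent :: "complex poly poly poly \<Rightarrow> complex poly poly poly \<Rightarrow> bool" where
  "equivalent F G \<longleftrightarrow> (\<exists>A. transforms_to F A G)"

definition GL3 :: "(complex ^ 3 ^ 3) monoid" where
  "GL3 = \<lparr>carrier = {A. invertible A}, monoid.mult = (**), one = mat 1\<rparr>"

definition scalars :: "(complex ^ 3 ^ 3) set" where
  "scalars = {mat c | c. c \<noteq> 0}"

definition symmetry_group :: "complex poly poly poly \<Rightarrow> (complex ^ 3 ^ 3) set" where
  "symmetry_group F = {A \<in> carrier GL3. \<forall>v. eval3 F (A *v v) = eval3 F v}"

text \<open>The class of a matrix in \<^term>\<open>GL3 Mod scalars\<close>\<close>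

definition proj_class :: "complex ^ 3 ^ 3 \<Rightarrow> (complex ^ 3 ^ 3) set" where
  "proj_class A = scalars #>\<^bsub>GL3\<^esub> A"

definition projective_symmetry_group ::
  "complex poly poly poly \<Rightarrow> (complex ^ 3 ^ 3) set set" where
  "projective_symmetry_group F = proj_class ` symmetry_group F"

definition cusp_matrix :: "complex \<Rightarrow> complex ^ 3 ^ 3" where
  "cusp_matrix \<alpha> =
     vector [vector [1, 0, 0],
             vector [0, \<alpha>, 0],
             vector [0, 0, 1 / \<alpha>\<^sup>2]]"

section \<open>Consistency of the encoding\<close>

lemma coeff_homogenize:
  "coeff (coeff (homogenize f) i) j =
     (if i + j \<le> 3 then monom (coeff (coeff f i) j) (3 - i - j) else 0)"
proof -
  have "coeff (coeff (homogenize f) i) j =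
      (\<Sum>i'\<le>3. \<Sum>j'\<le>3 - i'. if i' = i \<and> j' = j
         then monom (coeff (coeff f i) j) (3 - i - j) else 0)"
    unfolding homogenize_def coeff_sum
    by (intro sum.cong refl) (auto simp: coeff_sum)
  also have "\<dots> = (\<Sum>i'\<le>3. if i' = i then
       (if j \<le> 3 - i then monom (coeff (coeff f i) j) (3 - i - j) else 0) else 0)"
    by (intro sum.cong refl) auto
  also have "\<dots> = (if i + j \<le> 3 then monom (coeff (coeff f i) j) (3 - i - j) else 0)"
    by auto
  finally show ?thesis .
qed

lemma homogeneous_cubic_homogenize: "homogeneous_cubic (homogenize f)"
  by (auto simp: homogeneous_cubic_def coeff_homogenize split: if_splits)

lemma homogenize_dehomogenize:
  assumes "homogeneous_cubic F"
  shows "homogenize (dehomogenize F) = F"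
proof -
  have "coeff (coeff (coeff (homogenize (dehomogenize F)) i) j) k = coeff (coeff (coeff F i) j) k"
    for i j k
  proof (cases "i + j \<le> 3")
    case True
    let ?c = "coeff (coeff F i) j"
    have c: "?c = monom (coeff ?c (3 - i - j)) (3 - i - j)"
    proof (rule poly_eqI)
      fix n
      show "coeff ?c n = coeff (monom (coeff ?c (3 - i - j)) (3 - i - j)) n"
        using assms True unfolding homogeneous_cubic_def
        by (metis (no_types, lifting) coeff_monom diff_add_inverse diff_diff_left)
    qed
    have "poly ?c 1 = coeff ?c (3 - i - j)"
      by (subst c) (simp add: poly_monom)
    with c True show ?thesis
      by (simp add: coeff_homogenize dehomogenize_def coeff_map_poly)
  next
    case False
    with assms show ?thesis
      by (force simp: coeff_homogenize homogeneous_cubic_def)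
  qed
  then show ?thesis
    by (intro poly_eqI)
qed

lemma mat_mult_entry: "(mat c ** (A :: complex ^ 3 ^ 3)) $ i $ j = c * A $ i $ j"
  by (simp add: matrix_matrix_mult_def mat_def if_distrib if_distribR cong: if_cong)

lemma mult_mat_entry: "((A :: complex ^ 3 ^ 3) ** mat c) $ i $ j = A $ i $ j * c"
  by (simp add: matrix_matrix_mult_def mat_def if_distrib if_distribR cong: if_cong)

lemma mat_mult_mat: "mat c ** mat d = (mat (c * d) :: complex ^ 3 ^ 3)"
  by (simp add: vec_eq_iff mat_mult_entry) (simp add: mat_def)

lemma invertible_mat: "c \<noteq> 0 \<Longrightarrow> invertible (mat c :: complex ^ 3 ^ 3)"
  unfolding invertible_def by (rule exI[of _ "mat (1 / c)"]) (simp add: mat_mult_mat)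

lemma group_GL3: "group GL3"
proof (rule groupI)
  fix A assume "A \<in> carrier GL3"
  then show "\<exists>B\<in>carrier GL3. B \<otimes>\<^bsub>GL3\<^esub> A = \<one>\<^bsub>GL3\<^esub>"
    by (auto simp: GL3_def invertible_def)
qed (auto simp: GL3_def matrix_mul_assoc invertible_mult invertible_mat)

lemma normal_scalars: "scalars \<lhd> GL3"
proof -
  interpret group GL3 by (rule group_GL3)
  have inv: "inv\<^bsub>GL3\<^esub> (mat c) = mat (1 / c)" if "c \<noteq> 0" for c
    using that by (intro inv_equality) (auto simp: GL3_def mat_mult_mat invertible_mat)
  have "subgroup scalars GL3"
  proof (rule subgroupI)
    show "scalars \<subseteq> carrier GL3" by (auto simp: scalars_def GL3_def invertible_mat)
    show "scalars \<noteq> {}" by (auto simp: scalars_def intro: exI[of _ 1])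
    show "inv\<^bsub>GL3\<^esub> a \<in> scalars" if "a \<in> scalars" for a
      using that inv by (force simp: scalars_def)
    show "a \<otimes>\<^bsub>GL3\<^esub> b \<in> scalars" if "a \<in> scalars" "b \<in> scalars" for a b
      using that by (auto simp: scalars_def GL3_def mat_mult_mat)
  qed
  moreover have "scalars #>\<^bsub>GL3\<^esub> A = A <#\<^bsub>GL3\<^esub> scalars" for A
  proof -
    have "mat c ** A = A ** mat c" for c
      by (simp add: vec_eq_iff mat_mult_entry mult_mat_entry mult.commute)
    then have "x ** A = A ** x" if "x \<in> scalars" for x
      using that by (auto simp: scalars_def)
    then show ?thesis
      by (auto simp: r_coset_def l_coset_def GL3_def)
  qed
  ultimately show ?thesis
    by (simp add: normal_def normal_axioms_def group_GL3)
qed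

lemmas canonical_simps =
  homogenize_def eval3_def p_var_def q_var_def cst_def numeral_3_eq_3 power2_eq_square
  power3_eq_cube coeff_pCons atMost_Suc poly_monom

lemma eval3_cusp:
  "eval3 (homogenize (p_var ^ 3 - q_var ^ 2)) v = (v $ 1) ^ 3 - (v $ 2)\<^sup>2 * v $ 3"
  by (simp add: canonical_simps)

lemma eval3_node:
  "eval3 (homogenize (p_var ^ 2 * (p_var + 1) - q_var ^ 2)) v =
     (v $ 1)\<^sup>2 * (v $ 1 + v $ 3) - (v $ 2)\<^sup>2 * v $ 3"
  by (simp add: canonical_simps algebra_simps)

lemma eval3_family:
  "eval3 (homogenize (p_var ^ 3 + cst a * p_var + 1 - q_var ^ 2)) v =
     (v $ 1) ^ 3 + a * v $ 1 * (v $ 3)\<^sup>2 + (v $ 3) ^ 3 - (v $ 2)\<^sup>2 * v $ 3"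
  by (simp add: canonical_simps)

lemma eval3_harmonic:
  "eval3 (homogenize (p_var ^ 3 + p_var - q_var ^ 2)) v =
     (v $ 1) ^ 3 + v $ 1 * (v $ 3)\<^sup>2 - (v $ 2)\<^sup>2 * v $ 3"
  by (simp add: canonical_simps)

lemma eval3_equianharmonic:
  "eval3 (homogenize (p_var ^ 3 + 1 - q_var ^ 2)) v =
     (v $ 1) ^ 3 + (v $ 3) ^ 3 - (v $ 2)\<^sup>2 * v $ 3"
  by (simp add: canonical_simps)

lemma eval3_fermat:
  "eval3 (homogenize (p_var ^ 3 + q_var ^ 3 + 1)) v = (v $ 1) ^ 3 + (v $ 2) ^ 3 + (v $ 3) ^ 3"
  by (simp add: canonical_simps)

end

theory Submission
  imports Defs
begin

text \<open>
  Everything is done with the symmetric trilinear form of a cubic. If the curve is singular,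
  coordinates with the singular point at \<open>(0 : 0 : 1)\<close> turn the cubic into \<open>z Q(x, y) + C(x, y)\<close>, and
  the rank of \<open>Q\<close> separates the node \<open>x\<^sup>3 + y\<^sup>3 + x y z\<close> from the cusp; rank 0 contradicts irreducibility.

  If the curve is nonsingular, it has a flex, since it meets its Hessian. Putting a flex at
  \<open>(0 : 1 : 0)\<close> gives the Weierstrass form \<open>x\<^sup>3 + a x z\<^sup>2 + b z\<^sup>3 - y\<^sup>2 z\<close>, in which \<open>y \<mapsto> -y\<close> is an involutory
  symmetry, so every flex carries such an involution. The involution at a flex exchanges the two
  other flexes on a line through it, so the symmetry group acts transitively on the flexes.
  There are 9 of them, and the stabilizer of \<open>(0 : 1 : 0)\<close> is diagonal.
\<close>

(* With the power series notation enabled as well, each $ doubles the number of parses. *)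
no_notation fps_nth (infixl "$" 75)

section \<open>Cubic forms and their polarization\<close>

text \<open>Cubics are treated as functions on C^3, so that a linear change of variables is
  composition with a matrix; polynomials return only where irreducibility has to be carried through
  such changes.

  Counting is done for genuine symmetries. A scalar c preserves a nonzero cubic exactly if c^3 = 1,
  so every projective class contains three symmetries. In the smooth cases the stabilizers have 6,
  12 and 18 elements, and 9 * 6 / 3, 9 * 12 / 3, 9 * 18 / 3 are the stated numbers 18, 36, 54.

  The main obstacle is that the curve meets its Hessian, usually a case of Bezout's theorem. It is
  replaced by explicit elimination: once a point off the curve is at (0 : 1 : 0), the cubic is monic
  in y and a shift removes y^2, and the resultant of a depressed cubic and a quadratic is short
  enough to be written down.

  The node is studied in the form with xy as its tangent cone because there a symmetry can only
  scale or swap x and y.\<close>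

definition polar :: "(complex ^ 3 \<Rightarrow> complex) \<Rightarrow> complex ^ 3 \<Rightarrow> complex ^ 3 \<Rightarrow> complex ^ 3 \<Rightarrow> complex"
  where "polar f u v w =
    (f (u + v + w) - f (u + v) - f (u + w) - f (v + w) + f u + f v + f w) / 6"

lemma polar_commute: "polar f u v w = polar f v u w"
  by (simp add: polar_def add_ac)

lemma polar_commute2: "polar f u v w = polar f u w v"
  by (simp add: polar_def add_ac)

lemma polar_compose_matrix: "polar (\<lambda>v. f (A *v v)) u v w = polar f (A *v u) (A *v v) (A *v w)"
  by (simp add: polar_def matrix_vector_right_distrib)

text \<open>Trilinearity of the polarization together with its diagonal characterizes cubic forms,
  and it is stable under linear substitution. \<open>3 * polar f v v w\<close> is the derivative of
  \<open>f\<close> at \<open>v\<close> in direction \<open>w\<close>.\<close>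

locale cubic_form =
  fixes f :: "complex ^ 3 \<Rightarrow> complex"
  assumes add_left: "polar f (u + u') v w = polar f u v w + polar f u' v w"
    and scale_left: "polar f (c *s u) v w = c * polar f u v w"
    and diagonal: "polar f v v v = f v"
begin

lemma add_mid: "polar f v (u + u') w = polar f v u w + polar f v u' w"
  using add_left polar_commute by metis

lemma add_right: "polar f v w (u + u') = polar f v w u + polar f v w u'"
  using add_mid polar_commute2 by metis

lemma scale_mid: "polar f v (c *s u) w = c * polar f v u w"
  using scale_left polar_commute by metis

lemma scale_right: "polar f v w (c *s u) = c * polar f v w u"
  using scale_mid polar_commute2 by metis

lemmas trilinear = add_left add_mid add_right scale_left scale_mid scale_right

text \<open>The polar values of \<open>a\<close>, \<open>b\<close>, \<open>c\<close> are, up to the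
  factors 1, 3, 6, the coefficients in the coordinates x, y, z. Vectors with vanishing polar values
  therefore remove monomials.\<close>

lemma expand:
  "f (x *s a + y *s b + z *s c) =
    x ^ 3 * f a + y ^ 3 * f b + z ^ 3 * f c +
    3 * x\<^sup>2 * y * polar f a a b + 3 * x\<^sup>2 * z * polar f a a c + 3 * x * y\<^sup>2 * polar f a b b +
    3 * x * z\<^sup>2 * polar f a c c + 3 * y\<^sup>2 * z * polar f b b c + 3 * y * z\<^sup>2 * polar f b c c +
    6 * x * y * z * polar f a b c"
proof -
  let ?v = "x *s a + y *s b + z *s c"
  have sym: "polar f b a v = polar f a b v" "polar f c a v = polar f a c v"
    "polar f c b v = polar f b c v" "polar f a b a = polar f a a b" "polar f a c a = polar f a a c"
    "polar f a c b = polar f a b c" "polar f b c b = polar f b b c" "polar f b b a = polar f a b b"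
    "polar f b c a = polar f a b c" "polar f c c a = polar f a c c" "polar f c c b = polar f b c c" for v
    by (metis polar_commute polar_commute2)+
  have "f ?v = polar f ?v ?v ?v" by (simp add: diagonal)
  also have "\<dots> = x ^ 3 * polar f a a a + y ^ 3 * polar f b b b + z ^ 3 * polar f c c c +
    3 * x\<^sup>2 * y * polar f a a b + 3 * x\<^sup>2 * z * polar f a a c + 3 * x * y\<^sup>2 * polar f a b b +
    3 * x * z\<^sup>2 * polar f a c c + 3 * y\<^sup>2 * z * polar f b b c + 3 * y * z\<^sup>2 * polar f b c c +
    6 * x * y * z * polar f a b c"
    unfolding trilinear sym by algebra
  finally show ?thesis by (simp add: diagonal)
qed

lemma scale: "f (c *s v) = c ^ 3 * f v"
proof -
  have "f (c *s v) = polar f (c *s v) (c *s v) (c *s v)" by (simp add: diagonal)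
  also have "\<dots> = c ^ 3 * polar f v v v" by (simp add: trilinear(4-6) power3_eq_cube)
  finally show ?thesis by (simp add: diagonal)
qed

lemma compose_matrix: "cubic_form (\<lambda>v. f (A *v v))"
  by unfold_locales
    (simp_all add: polar_compose_matrix matrix_vector_right_distrib vector_scalar_commute trilinear diagonal)

end

lemma polar_add: "polar (\<lambda>v. f v + g v) u v w = polar f u v w + polar g u v w"
  by (simp add: polar_def field_simps)

lemma polar_diff: "polar (\<lambda>v. f v - g v) u v w = polar f u v w - polar g u v w"
  by (simp add: polar_def field_simps)

lemma polar_cmult: "polar (\<lambda>v. c * f v) u v w = c * polar f u v w"
  by (simp add: polar_def ring_distribs)

lemma polar_monomial:
  "polar (\<lambda>v. v $ i * v $ j * v $ k) u v w =
    (u $ i * v $ j * w $ k + u $ i * w $ j * v $ k + v $ i * u $ j * w $ k +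
     v $ i * w $ j * u $ k + w $ i * u $ j * v $ k + w $ i * v $ j * u $ k) / 6"
  by (simp add: polar_def algebra_simps)

lemma cubic_form_monomial: "cubic_form (\<lambda>v. v $ i * v $ j * v $ k)"
  by unfold_locales (unfold polar_monomial, simp_all add: field_simps)

lemma cubic_form_add: "cubic_form f \<Longrightarrow> cubic_form g \<Longrightarrow> cubic_form (\<lambda>v. f v + g v)"
  by (simp add: cubic_form_def polar_add algebra_simps)

lemma cubic_form_diff: "cubic_form f \<Longrightarrow> cubic_form g \<Longrightarrow> cubic_form (\<lambda>v. f v - g v)"
  by (simp add: cubic_form_def polar_diff algebra_simps)

lemma cubic_form_cmult: "cubic_form f \<Longrightarrow> cubic_form (\<lambda>v. c * f v)"
  by (simp add: cubic_form_def polar_cmult algebra_simps)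

lemmas cubic_form_intros = cubic_form_add cubic_form_diff cubic_form_cmult cubic_form_monomial

definition ternary_cubic :: "(nat \<Rightarrow> nat \<Rightarrow> nat \<Rightarrow> complex) \<Rightarrow> complex ^ 3 \<Rightarrow> complex" where
  "ternary_cubic c v =
     c 3 0 0 * (v $ 1 * v $ 1 * v $ 1) + c 2 1 0 * (v $ 1 * v $ 1 * v $ 2) +
     c 2 0 1 * (v $ 1 * v $ 1 * v $ 3) + c 1 2 0 * (v $ 1 * v $ 2 * v $ 2) +
     c 1 1 1 * (v $ 1 * v $ 2 * v $ 3) + c 1 0 2 * (v $ 1 * v $ 3 * v $ 3) +
     c 0 3 0 * (v $ 2 * v $ 2 * v $ 2) + c 0 2 1 * (v $ 2 * v $ 2 * v $ 3) +
     c 0 1 2 * (v $ 2 * v $ 3 * v $ 3) + c 0 0 3 * (v $ 3 * v $ 3 * v $ 3)"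

lemma cubic_form_ternary_cubic: "cubic_form (ternary_cubic c)"
  unfolding ternary_cubic_def by (intro cubic_form_intros)

text \<open>The three brackets are the partial derivatives at \<open>v\<close>: this is one third of
  the gradient paired with \<open>w\<close>.\<close>

lemma polar_ternary_cubic:
  "polar (ternary_cubic c) v v w =
     (w $ 1 * (3 * c 3 0 0 * (v $ 1)\<^sup>2 + 2 * c 2 1 0 * v $ 1 * v $ 2 + 2 * c 2 0 1 * v $ 1 * v $ 3 +
        c 1 2 0 * (v $ 2)\<^sup>2 + c 1 1 1 * v $ 2 * v $ 3 + c 1 0 2 * (v $ 3)\<^sup>2) +
      w $ 2 * (c 2 1 0 * (v $ 1)\<^sup>2 + 2 * c 1 2 0 * v $ 1 * v $ 2 + c 1 1 1 * v $ 1 * v $ 3 +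
        3 * c 0 3 0 * (v $ 2)\<^sup>2 + 2 * c 0 2 1 * v $ 2 * v $ 3 + c 0 1 2 * (v $ 3)\<^sup>2) +
      w $ 3 * (c 2 0 1 * (v $ 1)\<^sup>2 + c 1 1 1 * v $ 1 * v $ 2 + 2 * c 1 0 2 * v $ 1 * v $ 3 +
        c 0 2 1 * (v $ 2)\<^sup>2 + 2 * c 0 1 2 * v $ 2 * v $ 3 + 3 * c 0 0 3 * (v $ 3)\<^sup>2)) / 3"
  unfolding ternary_cubic_def polar_add polar_cmult polar_monomial
  by (simp add: field_simps power2_eq_square)

section \<open>Polynomials versus polynomial functions\<close>

lemma homogeneous_cubic_pCons:
  assumes "homogeneous_cubic F"
  obtains c :: "nat \<Rightarrow> nat \<Rightarrow> nat \<Rightarrow> complex" where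
    "F = [: [: [:0, 0, 0, c 0 0 3:], [:0, 0, c 0 1 2:], [:0, c 0 2 1:], [:c 0 3 0:] :],
    [: [:0, 0, c 1 0 2:], [:0, c 1 1 1:], [:c 1 2 0:] :],
    [: [:0, c 2 0 1:], [:c 2 1 0:] :], [: [:c 3 0 0:] :] :]"
proof -
  let ?c = "\<lambda>i j k. coeff (coeff (coeff F i) j) k"
  let ?G = "[: [: [:0, 0, 0, ?c 0 0 3:], [:0, 0, ?c 0 1 2:], [:0, ?c 0 2 1:], [:?c 0 3 0:] :],
    [: [:0, 0, ?c 1 0 2:], [:0, ?c 1 1 1:], [:?c 1 2 0:] :],
    [: [:0, ?c 2 0 1:], [:?c 2 1 0:] :], [: [:?c 3 0 0:] :] :]"
  have z: "?c i j k = 0" if "i + j + k \<noteq> 3" for i j k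
    using assms(1) that unfolding homogeneous_cubic_def by blast
  have "coeff (coeff (coeff ?G i) j) k = ?c i j k" for i j k
    by (cases "i + j + k = 3")
      (auto simp: coeff_pCons z numeral_3_eq_3 numeral_2_eq_2 split: nat.splits)
  then have "F = ?G" by (intro poly_eqI) metis
  then show ?thesis by (rule that[of ?c])
qed

lemma cubic_form_eval3:
  assumes "homogeneous_cubic F"
  shows "cubic_form (eval3 F)"
proof -
  obtain c :: "nat \<Rightarrow> nat \<Rightarrow> nat \<Rightarrow> complex" where
    F: "F = [: [: [:0, 0, 0, c 0 0 3:], [:0, 0, c 0 1 2:], [:0, c 0 2 1:], [:c 0 3 0:] :],
    [: [:0, 0, c 1 0 2:], [:0, c 1 1 1:], [:c 1 2 0:] :],
    [: [:0, c 2 0 1:], [:c 2 1 0:] :], [: [:c 3 0 0:] :] :]"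
    using homogeneous_cubic_pCons[OF assms] by blast
  have "eval3 F = ternary_cubic c"
    unfolding F by (rule ext) (simp add: eval3_def ternary_cubic_def algebra_simps)
  then show ?thesis by (simp add: cubic_form_ternary_cubic)
qed

lemma polar_eval3:
  assumes "homogeneous_cubic F"
  shows "polar (eval3 F) v v w = (w $ 1 * eval3 (deriv_x F) v + w $ 2 * eval3 (deriv_y F) v +
           w $ 3 * eval3 (deriv_z F) v) / 3"
proof -
  obtain c :: "nat \<Rightarrow> nat \<Rightarrow> nat \<Rightarrow> complex" where
    F: "F = [: [: [:0, 0, 0, c 0 0 3:], [:0, 0, c 0 1 2:], [:0, c 0 2 1:], [:c 0 3 0:] :],
    [: [:0, 0, c 1 0 2:], [:0, c 1 1 1:], [:c 1 2 0:] :],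
    [: [:0, c 2 0 1:], [:c 2 1 0:] :], [: [:c 3 0 0:] :] :]"
    using homogeneous_cubic_pCons[OF assms] by blast
  have "eval3 F = ternary_cubic c"
    unfolding F by (rule ext) (simp add: eval3_def ternary_cubic_def algebra_simps)
  moreover have "eval3 (deriv_x F) v = 3 * c 3 0 0 * (v $ 1)\<^sup>2 + 2 * c 2 1 0 * v $ 1 * v $ 2 +
      2 * c 2 0 1 * v $ 1 * v $ 3 + c 1 2 0 * (v $ 2)\<^sup>2 + c 1 1 1 * v $ 2 * v $ 3 + c 1 0 2 * (v $ 3)\<^sup>2"
    unfolding F by (simp add: eval3_def deriv_x_def pderiv_pCons power2_eq_square algebra_simps)
  moreover have "eval3 (deriv_y F) v = c 2 1 0 * (v $ 1)\<^sup>2 + 2 * c 1 2 0 * v $ 1 * v $ 2 +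
      c 1 1 1 * v $ 1 * v $ 3 + 3 * c 0 3 0 * (v $ 2)\<^sup>2 + 2 * c 0 2 1 * v $ 2 * v $ 3 + c 0 1 2 * (v $ 3)\<^sup>2"
    unfolding F by (simp add: eval3_def deriv_y_def map_poly_pCons pderiv_pCons power2_eq_square algebra_simps)
  moreover have "eval3 (deriv_z F) v = c 2 0 1 * (v $ 1)\<^sup>2 + c 1 1 1 * v $ 1 * v $ 2 +
      2 * c 1 0 2 * v $ 1 * v $ 3 + c 0 2 1 * (v $ 2)\<^sup>2 + 2 * c 0 1 2 * v $ 2 * v $ 3 + 3 * c 0 0 3 * (v $ 3)\<^sup>2"
    unfolding F by (simp add: eval3_def deriv_z_def map_poly_pCons pderiv_pCons power2_eq_square algebra_simps)
  ultimately show ?thesis by (simp add: polar_ternary_cubic)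
qed

text \<open>That \<open>v\<close> lies on the curve is implicit, because
  \<open>polar f v v v = f v\<close> is among the vanishing values.\<close>

locale smooth_cubic = cubic_form +
  assumes smooth: "(\<And>w. polar f v v w = 0) \<Longrightarrow> v = 0"

lemma singular_curve_iff:
  assumes "homogeneous_cubic F"
  shows "singular_curve F \<longleftrightarrow> (\<exists>v. v \<noteq> 0 \<and> (\<forall>w. polar (eval3 F) v v w = 0))"
proof -
  interpret cubic_form "eval3 F" by (rule cubic_form_eval3[OF assms])
  have "eval3 F v = 0 \<and> eval3 (deriv_x F) v = 0 \<and> eval3 (deriv_y F) v = 0 \<and> eval3 (deriv_z F) v = 0
    \<longleftrightarrow> (\<forall>w. polar (eval3 F) v v w = 0)" (is "?L \<longleftrightarrow> ?R") for v
  proof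
    show "?L \<Longrightarrow> ?R" by (simp add: polar_eval3[OF assms])
    assume ?R
    then have "eval3 F v = 0" using diagonal by metis
    moreover have "eval3 (deriv_x F) v = 0" "eval3 (deriv_y F) v = 0" "eval3 (deriv_z F) v = 0"
      using \<open>?R\<close>[rule_format, of "axis 1 1"] \<open>?R\<close>[rule_format, of "axis 2 1"]
        \<open>?R\<close>[rule_format, of "axis 3 1"]
      unfolding polar_eval3[OF assms] by (simp_all add: axis_def)
    ultimately show ?L by simp
  qed
  then show ?thesis unfolding singular_curve_def by metis
qed

lemma smooth_cubic_iff:
  assumes "homogeneous_cubic F"
  shows "smooth_cubic (eval3 F) \<longleftrightarrow> \<not> singular_curve F"
  using cubic_form_eval3[OF assms] unfolding singular_curve_iff[OF assms] smooth_cubic_def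
    smooth_cubic_axioms_def by blast

lemma eval3_simps [simp]:
  "eval3 (F + G) v = eval3 F v + eval3 G v" "eval3 (F * G) v = eval3 F v * eval3 G v"
  "eval3 0 v = 0" "eval3 1 v = 1"
  by (simp_all add: eval3_def)

lemma poly_eq_if_infinite:
  fixes p q :: "'a :: idom poly"
  assumes "infinite A" "\<And>x. x \<in> A \<Longrightarrow> poly p x = poly q x"
  shows "p = q"
proof -
  have "A \<subseteq> {x. poly (p - q) x = 0}" using assms(2) by auto
  then have "infinite {x. poly (p - q) x = 0}" using assms(1) finite_subset by blast
  then have "p - q = 0" using poly_roots_finite by blast
  then show ?thesis by simp
qed

text \<open>The indeterminates are peeled off from the outside: at each level the complex constants
  form an infinite subset of the coefficient domain, and equality at all of them forces equality of
  the polynomials.\<close>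

lemma eval3_inject:
  assumes "eval3 F = eval3 G" shows "F = G"
proof (rule poly_eq_if_infinite)
  show "infinite (range (\<lambda>x::complex. [:[:x:]:]))"
    by (simp add: finite_image_iff inj_on_def infinite_UNIV_char_0)
  fix a assume "a \<in> range (\<lambda>x::complex. [:[:x:]:])"
  then obtain x where x: "a = [:[:x:]:]" by auto
  show "poly F a = poly G a"
  proof (rule poly_eq_if_infinite)
    show "infinite (range (\<lambda>x::complex. [:x:]))"
      by (simp add: finite_image_iff inj_on_def infinite_UNIV_char_0)
    fix b assume "b \<in> range (\<lambda>x::complex. [:x:])"
    then obtain y where y: "b = [:y:]" by auto
    show "poly (poly F a) b = poly (poly G a) b"
    proof (rule poly_eq_if_infinite[OF infinite_UNIV_char_0])
      fix z :: complex
      show "poly (poly (poly F a) b) z = poly (poly (poly G a) b) z"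
        using fun_cong[OF assms, of "vector [x, y, z]"] by (simp add: eval3_def x y)
    qed
  qed
qed

section \<open>Polynomial functions and factorizations\<close>

definition polynomial_fun :: "(complex ^ 3 \<Rightarrow> complex) \<Rightarrow> bool" where
  "polynomial_fun g \<longleftrightarrow> (\<exists>G. g = eval3 G)"

lemma polynomial_fun_const [intro]: "polynomial_fun (\<lambda>v. c)"
  unfolding polynomial_fun_def by (rule exI[of _ "[:[:[:c:]:]:]"]) (simp add: eval3_def fun_eq_iff)

lemma polynomial_fun_coord [intro]: "polynomial_fun (\<lambda>v. v $ i)"
proof -
  have "polynomial_fun (\<lambda>v. v $ 1)"
    unfolding polynomial_fun_def by (rule exI[of _ "[:0, 1:]"]) (simp add: eval3_def fun_eq_iff)
  moreover have "polynomial_fun (\<lambda>v. v $ 2)"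
    unfolding polynomial_fun_def by (rule exI[of _ "[:[:0, 1:]:]"]) (simp add: eval3_def fun_eq_iff)
  moreover have "polynomial_fun (\<lambda>v. v $ 3)"
    unfolding polynomial_fun_def by (rule exI[of _ "[:[:[:0, 1:]:]:]"]) (simp add: eval3_def fun_eq_iff)
  ultimately show ?thesis using exhaust_3[of i] by auto
qed

lemma polynomial_fun_add [intro]:
  assumes "polynomial_fun g" "polynomial_fun h"
  shows "polynomial_fun (\<lambda>v. g v + h v)"
proof -
  obtain G H where "g = eval3 G" "h = eval3 H"
    using assms by (auto simp: polynomial_fun_def)
  then have "(\<lambda>v. g v + h v) = eval3 (G + H)" by (simp add: fun_eq_iff)
  then show ?thesis by (auto simp: polynomial_fun_def)
qed

lemma polynomial_fun_mult [intro]: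
  assumes "polynomial_fun g" "polynomial_fun h"
  shows "polynomial_fun (\<lambda>v. g v * h v)"
proof -
  obtain G H where "g = eval3 G" "h = eval3 H"
    using assms by (auto simp: polynomial_fun_def)
  then have "(\<lambda>v. g v * h v) = eval3 (G * H)" by (simp add: fun_eq_iff)
  then show ?thesis by (auto simp: polynomial_fun_def)
qed

lemma polynomial_fun_matrix_coord [intro]: "polynomial_fun (\<lambda>v. ((A::complex^3^3) *v v) $ i)"
  unfolding matrix_vector_mult_def sum_3 vec_lambda_beta
  by (intro polynomial_fun_add polynomial_fun_mult polynomial_fun_const polynomial_fun_coord)

text \<open>Vanishing at the origin stands in for being a non-unit: the values of a unit are never
  0.\<close>

lemma irreducible_no_factor:
  assumes "irreducible F" "polynomial_fun g" "polynomial_fun h" "g 0 = 0" "h 0 = 0"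
    and "\<And>v. eval3 F v = g v * h v"
  shows False
proof -
  obtain G H where GH: "g = eval3 G" "h = eval3 H"
    using assms by (auto simp: polynomial_fun_def)
  have "F = G * H" by (rule eval3_inject) (simp add: assms(6) GH fun_eq_iff)
  then have "is_unit G \<or> is_unit H" using assms(1) by (auto dest: irreducibleD)
  moreover have "eval3 U 0 \<noteq> 0" if "is_unit U" for U
  proof -
    obtain V where "1 = U * V" using \<open>is_unit U\<close> by (elim dvdE)
    then have "eval3 U 0 * eval3 V 0 = 1" by (metis eval3_simps(2,4))
    then show ?thesis by auto
  qed
  ultimately show False using assms(4,5) unfolding GH by blast
qed

section \<open>Linear equivalence of functions\<close>

definition lin_equiv :: "(complex ^ 3 \<Rightarrow> complex) \<Rightarrow> (complex ^ 3 \<Rightarrow> complex) \<Rightarrow> bool" where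
  "lin_equiv f g \<longleftrightarrow> (\<exists>A. invertible A \<and> (\<forall>v. g v = f (A *v v)))"

lemma equivalent_iff_lin_equiv: "equivalent F G \<longleftrightarrow> lin_equiv (eval3 F) (eval3 G)"
  by (simp add: equivalent_def transforms_to_def lin_equiv_def)

lemma lin_equiv_trans: "lin_equiv f g \<Longrightarrow> lin_equiv g h \<Longrightarrow> lin_equiv f h"
  unfolding lin_equiv_def by (metis invertible_mult matrix_vector_mul_assoc)

lemma invertible_iff_det: "invertible (A :: complex ^ 3 ^ 3) \<longleftrightarrow> det A \<noteq> 0"
  by (simp add: invertible_det_nz)

lemma matrix_inv:
  fixes A :: "complex ^ 3 ^ 3"
  assumes "invertible A"
  shows "A ** matrix_inv A = mat 1" "matrix_inv A ** A = mat 1" "invertible (matrix_inv A)"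
proof -
  have "A ** matrix_inv A = mat 1 \<and> matrix_inv A ** A = mat 1"
    unfolding matrix_inv_def using assms[unfolded invertible_def] by (rule someI_ex)
  then show "A ** matrix_inv A = mat 1" "matrix_inv A ** A = mat 1" "invertible (matrix_inv A)"
    by (auto simp: invertible_def)
qed

lemma matrix_inv_vector:
  fixes A :: "complex ^ 3 ^ 3"
  assumes "invertible A"
  shows "A *v (matrix_inv A *v v) = v" "matrix_inv A *v (A *v v) = v"
  by (simp_all add: matrix_vector_mul_assoc matrix_inv assms)

lemma invertible_mult_eq_0:
  fixes A :: "complex ^ 3 ^ 3"
  assumes "invertible A"
  shows "A *v v = 0 \<longleftrightarrow> v = 0"
  by (metis assms matrix_inv_vector(2) matrix_vector_mult_0_right)

lemma cubic_form_lin_equiv: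
  assumes "cubic_form f" "lin_equiv f g"
  shows "cubic_form g"
proof -
  obtain A where "g = (\<lambda>v. f (A *v v))"
    using assms(2) by (auto simp: lin_equiv_def fun_eq_iff)
  then show ?thesis using cubic_form.compose_matrix[OF assms(1)] by simp
qed

lemma smooth_cubic_lin_equiv:
  assumes "smooth_cubic f" "lin_equiv f g"
  shows "smooth_cubic g"
proof -
  obtain A where A: "invertible A" "g = (\<lambda>v. f (A *v v))"
    using assms(2) by (auto simp: lin_equiv_def fun_eq_iff)
  show ?thesis
  proof (intro smooth_cubic.intro smooth_cubic_axioms.intro)
    show "cubic_form g"
      using assms cubic_form_lin_equiv smooth_cubic.axioms(1) by blast
    fix v assume "\<And>w. polar g v v w = 0"
    then have "polar f (A *v v) (A *v v) (A *v (matrix_inv A *v w)) = 0" for w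
      unfolding A(2) polar_compose_matrix .
    then have "A *v v = 0"
      using smooth_cubic.smooth[OF assms(1)] by (simp add: matrix_inv_vector A(1))
    then show "v = 0" using A(1) invertible_mult_eq_0 by blast
  qed
qed

section \<open>Explicit matrices and completion to a basis\<close>

definition matrix3 :: "complex \<Rightarrow> complex \<Rightarrow> complex \<Rightarrow> complex \<Rightarrow> complex \<Rightarrow> complex \<Rightarrow>
    complex \<Rightarrow> complex \<Rightarrow> complex \<Rightarrow> complex ^ 3 ^ 3" where
  "matrix3 a b c d e f g h i = vector [vector [a, b, c], vector [d, e, f], vector [g, h, i]]"

lemma matrix3_nth [simp]:
  "matrix3 a b c d e f g h i $ 1 $ 1 = a" "matrix3 a b c d e f g h i $ 1 $ 2 = b"
  "matrix3 a b c d e f g h i $ 1 $ 3 = c" "matrix3 a b c d e f g h i $ 2 $ 1 = d"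
  "matrix3 a b c d e f g h i $ 2 $ 2 = e" "matrix3 a b c d e f g h i $ 2 $ 3 = f"
  "matrix3 a b c d e f g h i $ 3 $ 1 = g" "matrix3 a b c d e f g h i $ 3 $ 2 = h"
  "matrix3 a b c d e f g h i $ 3 $ 3 = i"
  by (simp_all add: matrix3_def)

lemma matrix3_eqI:
  fixes A B :: "complex ^ 3 ^ 3"
  assumes "A $ 1 $ 1 = B $ 1 $ 1" "A $ 1 $ 2 = B $ 1 $ 2" "A $ 1 $ 3 = B $ 1 $ 3"
    "A $ 2 $ 1 = B $ 2 $ 1" "A $ 2 $ 2 = B $ 2 $ 2" "A $ 2 $ 3 = B $ 2 $ 3"
    "A $ 3 $ 1 = B $ 3 $ 1" "A $ 3 $ 2 = B $ 3 $ 2" "A $ 3 $ 3 = B $ 3 $ 3"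
  shows "A = B"
  using assms by (simp add: vec_eq_iff forall_3)

lemma matrix_vector_mult_nth:
  "((A :: complex ^ 3 ^ 3) *v v) $ i = A $ i $ 1 * v $ 1 + A $ i $ 2 * v $ 2 + A $ i $ 3 * v $ 3"
  by (simp add: matrix_vector_mult_def sum_3)

lemma det_matrix3:
  "det (matrix3 a b c d e f g h i) = a * (e * i - f * h) - b * (d * i - f * g) + c * (d * h - e * g)"
  by (simp add: det_3 algebra_simps)

lemma lin_equiv_matrix3:
  assumes "\<And>v. g v = f (matrix3 a11 a12 a13 a21 a22 a23 a31 a32 a33 *v v)"
    and "a11 * (a22 * a33 - a23 * a32) - a12 * (a21 * a33 - a23 * a31) + a13 * (a21 * a32 - a22 * a31) \<noteq> 0"
  shows "lin_equiv f g"
  using assms unfolding lin_equiv_def by (metis det_matrix3 invertible_iff_det)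

definition cols :: "complex ^ 3 \<Rightarrow> complex ^ 3 \<Rightarrow> complex ^ 3 \<Rightarrow> complex ^ 3 ^ 3" where
  "cols a b c = matrix3 (a $ 1) (b $ 1) (c $ 1) (a $ 2) (b $ 2) (c $ 2) (a $ 3) (b $ 3) (c $ 3)"

lemma cols_mult: "cols a b c *v v = v $ 1 *s a + v $ 2 *s b + v $ 3 *s c"
  by (simp add: vec_eq_iff forall_3 matrix_vector_mult_nth cols_def mult.commute)

lemma cols_swap: "invertible (cols a b c) \<Longrightarrow> invertible (cols a c b)"
  by (simp add: invertible_iff_det cols_def det_matrix3 algebra_simps)

text \<open>If no \<open>e\<close> works, the determinants with the three coordinate vectors vanish;
  they are the components of the cross product of \<open>d\<close> and \<open>P\<close>, which would
  then be proportional.\<close>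

lemma extend_basis2:
  assumes "P \<noteq> 0" "\<And>s. d \<noteq> s *s P"
  obtains e where "invertible (cols d P e)"
proof (rule ccontr)
  assume "\<not> thesis"
  then have "det (cols d P e) = 0" for e
    using that invertible_iff_det by blast
  from this[of "axis 1 1"] this[of "axis 2 1"] this[of "axis 3 1"]
  have *: "d $ 2 * P $ 3 = d $ 3 * P $ 2" "d $ 1 * P $ 3 = d $ 3 * P $ 1" "d $ 1 * P $ 2 = d $ 2 * P $ 1"
    by (simp_all add: cols_def det_matrix3 axis_def algebra_simps)
  obtain i where "P $ i \<noteq> 0" using \<open>P \<noteq> 0\<close> by (auto simp: vec_eq_iff)
  then have "d = (d $ i / P $ i) *s P"
    using * exhaust_3[of i] by (auto simp: vec_eq_iff forall_3 field_simps)
  then show False using assms(2) by blast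
qed

lemma extend_basis1:
  assumes "P \<noteq> 0"
  obtains d e where "invertible (cols d P e)"
proof -
  obtain d where "\<forall>s. d \<noteq> s *s P"
  proof (cases "P $ 2 = 0 \<and> P $ 3 = 0")
    case True
    then show ?thesis by (intro that[of "axis 2 1"]) (auto simp: vec_eq_iff forall_3 axis_def)
  next
    case False
    then show ?thesis by (intro that[of "axis 1 1"]) (auto simp: vec_eq_iff forall_3 axis_def)
  qed
  then show ?thesis using extend_basis2[of P d] assms that by blast
qed

section \<open>Flexes and the Weierstrass form\<close>

text \<open>On the line through \<open>P\<close> in direction \<open>d\<close>, the cubic is a
  polynomial in the parameter with coefficients \<open>f P\<close>,
  \<open>3 * polar f P P d\<close>, \<open>3 * polar f P d d\<close>, \<open>f d\<close>. The
  conditions say that the line has contact of order at least three at \<open>P\<close>.\<close>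

definition is_flex :: "(complex ^ 3 \<Rightarrow> complex) \<Rightarrow> complex ^ 3 \<Rightarrow> bool" where
  "is_flex f P \<longleftrightarrow> P \<noteq> 0 \<and> f P = 0 \<and>
     (\<exists>d. (\<forall>s. d \<noteq> s *s P) \<and> polar f P P d = 0 \<and> polar f P d d = 0)"

lemma is_flex_compose:
  assumes "invertible A" "is_flex (\<lambda>v. f (A *v v)) P"
  shows "is_flex f (A *v P)"
proof -
  obtain d where d: "\<forall>s. d \<noteq> s *s P" "polar f (A *v P) (A *v P) (A *v d) = 0"
    "polar f (A *v P) (A *v d) (A *v d) = 0"
    using assms(2) by (auto simp: is_flex_def polar_compose_matrix)
  have "A *v d \<noteq> s *s (A *v P)" for s
    using d(1) assms(1) by (metis matrix_inv_vector(2) vector_scalar_commute)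
  then show ?thesis
    using assms d by (auto simp: is_flex_def invertible_mult_eq_0)
qed

lemma (in cubic_form) is_flex_scale: "is_flex f P \<Longrightarrow> c \<noteq> 0 \<Longrightarrow> is_flex f (c *s P)"
  unfolding is_flex_def
  by (auto simp: scale trilinear vector_smult_assoc)

text \<open>Equivalence that records the flex: the vector (0, 1, 0) is sent to \<open>P\<close>
  itself. The target takes three numbers so that substitutions can be chained.\<close>

definition equiv_at ::
  "complex ^ 3 \<Rightarrow> (complex ^ 3 \<Rightarrow> complex) \<Rightarrow> (complex \<Rightarrow> complex \<Rightarrow> complex \<Rightarrow> complex) \<Rightarrow> bool" where
  "equiv_at P f h \<longleftrightarrow>
     (\<exists>B :: complex ^ 3 ^ 3. invertible B \<and> B *v axis 2 1 = P \<and> (\<forall>v. f (B *v v) = h (v $ 1) (v $ 2) (v $ 3)))"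

text \<open>The middle column of the substitution is (0, 1, 0), so the flex stays in place.\<close>

lemma equiv_at_subst:
  assumes "equiv_at P f h" "a11 \<noteq> 0" "a33 \<noteq> 0"
    and "\<And>x y z. k x y z = h (a11 * x + a13 * z) (a21 * x + y + a23 * z) (a33 * z)"
  shows "equiv_at P f k"
proof -
  obtain B :: "complex ^ 3 ^ 3" where B: "invertible B" "B *v axis 2 1 = P" "\<And>v. f (B *v v) = h (v $ 1) (v $ 2) (v $ 3)"
    using assms(1) by (auto simp: equiv_at_def)
  let ?C = "matrix3 a11 0 a13 a21 1 a23 0 0 a33"
  have "?C *v axis 2 1 = axis 2 1"
    by (simp add: vec_eq_iff forall_3 matrix_vector_mult_nth axis_def)
  moreover have "invertible ?C"
    using assms(2,3) by (simp add: invertible_iff_det det_matrix3)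
  moreover have "f (B *v (?C *v v)) = k (v $ 1) (v $ 2) (v $ 3)" for v
    by (simp add: B(3) assms(4) matrix_vector_mult_nth)
  ultimately show ?thesis
    unfolding equiv_at_def using B(1,2)
    by (intro exI[of _ "B ** ?C"]) (simp add: invertible_mult matrix_vector_mul_assoc[symmetric])
qed

lemma complex_quadratic_root:
  fixes a b c :: complex
  assumes "a \<noteq> 0"
  obtains r where "a * r\<^sup>2 + b * r + c = 0"
proof -
  have "\<exists>r. poly [:c, b, a:] r = 0"
    by (rule alg_closed_imp_poly_has_root) (simp add: assms)
  then show ?thesis using that by (auto simp: power2_eq_square algebra_simps)
qed

definition weierstrass :: "complex \<Rightarrow> complex \<Rightarrow> complex ^ 3 \<Rightarrow> complex" where
  "weierstrass a b v = v $ 1 ^ 3 + a * v $ 1 * (v $ 3)\<^sup>2 + b * v $ 3 ^ 3 - (v $ 2)\<^sup>2 * v $ 3"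

context smooth_cubic
begin

text \<open>If \<open>polar f P P e\<close> were 0, the gradient at \<open>P\<close> would vanish.
  If \<open>f d\<close> were 0, the curve would contain the tangent line, along which only the
  derivative in direction \<open>e\<close> can survive; at d + y P it is a quadratic in y, and its
  root would be a singular point.\<close>

lemma flex_coefficients_nonzero:
  assumes "invertible (cols d P e)" "f P = 0" "polar f P P d = 0" "polar f P d d = 0"
  shows "f d \<noteq> 0" "polar f P P e \<noteq> 0"
proof -
  have basis: "v = 0" if "polar f v v d = 0" "polar f v v P = 0" "polar f v v e = 0" for v
  proof (rule smooth)
    fix w
    obtain u where "w = cols d P e *v u" using matrix_inv_vector(1)[OF assms(1)] by metis
    then have "w = u $ 1 *s d + u $ 2 *s P + u $ 3 *s e" by (simp add: cols_mult)
    then show "polar f v v w = 0" using that by (simp add: trilinear)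
  qed
  have nz: "x = 0 \<and> y = 0" if "x *s d + y *s P = 0" for x y
  proof -
    have "cols d P e *v vector [x, y, 0] = 0" using that by (simp add: cols_mult)
    then have "vector [x, y, 0] = (0 :: complex ^ 3)" using assms(1) invertible_mult_eq_0 by blast
    then show ?thesis by (simp add: vec_eq_iff forall_3)
  qed
  have "P \<noteq> 0" using nz[of 0 1] by auto
  moreover have "polar f P P P = 0" using assms(2) diagonal by simp
  ultimately show e: "polar f P P e \<noteq> 0" using basis assms(3) by blast
  show "f d \<noteq> 0"
  proof
    assume fd: "f d = 0"
    obtain y where y: "polar f P P e * y\<^sup>2 + 2 * polar f P d e * y + polar f d d e = 0"
      using complex_quadratic_root[OF e] by blast
    let ?v = "1 *s d + y *s P"
    have sym: "polar f d P w = polar f P d w" "polar f d d P = polar f P d d" "polar f P d P = polar f P P d" for w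
      by (metis polar_commute polar_commute2)+
    have "polar f ?v ?v e = 0"
      using y unfolding trilinear sym by (simp add: power2_eq_square algebra_simps)
    moreover have "polar f ?v ?v d = 0" "polar f ?v ?v P = 0"
      using assms fd by (simp_all add: trilinear sym diagonal)
    ultimately have "?v = 0" using basis by blast
    then show False using nz[of 1 y] by simp
  qed
qed

lemma flex_weierstrass:
  assumes "is_flex f P"
  obtains B :: "complex ^ 3 ^ 3" and a b where "invertible B" "B *v axis 2 1 = P" "\<And>v. f (B *v v) = weierstrass a b v"
proof -
  obtain d where d: "P \<noteq> 0" "f P = 0" "\<And>s. d \<noteq> s *s P" "polar f P P d = 0" "polar f P d d = 0"
    using assms by (auto simp: is_flex_def)
  obtain e where e: "invertible (cols d P e)" using extend_basis2 d by metis
  define \<beta> where "\<beta> = 3 * polar f P P e"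
  define \<gamma> where "\<gamma> = 6 * polar f d P e"
  define \<delta> where "\<delta> = 3 * polar f d d e"
  define \<epsilon> where "\<epsilon> = 3 * polar f P e e"
  define \<zeta> where "\<zeta> = 3 * polar f d e e"
  define c1 where "c1 = \<delta> - \<gamma>\<^sup>2 / (4 * \<beta>)"
  define c2 where "c2 = \<zeta> - \<gamma> * \<epsilon> / (2 * \<beta>)"
  define c3 where "c3 = f e - \<epsilon>\<^sup>2 / (4 * \<beta>)"
  have nz: "f d \<noteq> 0" "\<beta> \<noteq> 0"
    using flex_coefficients_nonzero[OF e d(2,4,5)] by (simp_all add: \<beta>_def)
  have sym: "polar f d d P = polar f P d d" "polar f d P P = polar f P P d"
    by (metis polar_commute polar_commute2)+
  \<comment> \<open>The flex conditions remove y^3, x y^2 and x^2 y.\<close>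
  have "equiv_at P f (\<lambda>x y z. f d * x ^ 3 + z * (\<beta> * y\<^sup>2 + \<gamma> * x * y + \<delta> * x\<^sup>2) +
    z\<^sup>2 * (\<epsilon> * y + \<zeta> * x) + f e * z ^ 3)"
    unfolding equiv_at_def
  proof (intro exI[of _ "cols d P e"] conjI allI)
    show "cols d P e *v axis 2 1 = P" by (simp add: cols_mult axis_def)
    fix v
    show "f (cols d P e *v v) = f d * v $ 1 ^ 3 + v $ 3 * (\<beta> * (v $ 2)\<^sup>2 + \<gamma> * v $ 1 * v $ 2 + \<delta> * (v $ 1)\<^sup>2) +
      (v $ 3)\<^sup>2 * (\<epsilon> * v $ 2 + \<zeta> * v $ 1) + f e * v $ 3 ^ 3"
      unfolding cols_mult expand sym by (simp add: d \<beta>_def \<gamma>_def \<delta>_def \<epsilon>_def \<zeta>_def algebra_simps)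
  qed fact
  \<comment> \<open>Complete the square in y.\<close>
  then have "equiv_at P f (\<lambda>x y z. f d * x ^ 3 + \<beta> * y\<^sup>2 * z + c1 * x\<^sup>2 * z + c2 * x * z\<^sup>2 + c3 * z ^ 3)"
    by (rule equiv_at_subst[of _ _ _ 1 1 _ 0 "- \<gamma> / (2 * \<beta>)" "- \<epsilon> / (2 * \<beta>)"])
      (use nz in \<open>simp_all add: c1_def c2_def c3_def field_simps power2_eq_square power3_eq_cube\<close>)
  \<comment> \<open>Complete the cube in x.\<close>
  then have "equiv_at P f (\<lambda>x y z. f d * x ^ 3 + \<beta> * y\<^sup>2 * z + (c2 - c1\<^sup>2 / (3 * f d)) * x * z\<^sup>2 +
     (c3 + 2 * c1 ^ 3 / (27 * (f d)\<^sup>2) - c1 * c2 / (3 * f d)) * z ^ 3)"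
    by (rule equiv_at_subst[of _ _ _ 1 1 _ "- c1 / (3 * f d)" 0 0])
      (use nz in \<open>simp_all add: field_simps power2_eq_square power3_eq_cube\<close>)
  \<comment> \<open>Only x and z are rescaled, since scaling y would move the vector
    \<open>P\<close>.\<close>
  moreover obtain r where r: "r ^ 3 = 1 / f d" using exists_complex_root[of 3] by (metis zero_neq_numeral)
  moreover have "r \<noteq> 0" using r nz by auto
  ultimately have "equiv_at P f (\<lambda>x y z. x ^ 3 + (r / \<beta>\<^sup>2 * (c2 - c1\<^sup>2 / (3 * f d))) * x * z\<^sup>2 +
     (- (c3 + 2 * c1 ^ 3 / (27 * (f d)\<^sup>2) - c1 * c2 / (3 * f d)) / \<beta> ^ 3) * z ^ 3 - y\<^sup>2 * z)"
    by (elim equiv_at_subst[of _ _ _ r "- 1 / \<beta>" _ 0 0 0])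
      (use nz in \<open>simp_all add: power_mult_distrib r power_divide power2_eq_square power3_eq_cube field_simps\<close>)
  then show ?thesis
    using that unfolding equiv_at_def weierstrass_def by blast
qed

text \<open>The sign change of y in Weierstrass form moves every point along its line through the
  flex. This shape, kept in the third property, is what allows the image of another flex to be
  computed.\<close>

lemma flex_involution:
  assumes "is_flex f P"
  obtains S :: "complex ^ 3 ^ 3" and l where "invertible S" "\<And>v. f (S *v v) = f v" "\<And>v. S *v v = v - l v *s P" "S *v P = - P"
proof -
  obtain B :: "complex ^ 3 ^ 3" and a b where B: "invertible B" "B *v axis 2 1 = P" "\<And>v. f (B *v v) = weierstrass a b v"
    using flex_weierstrass[OF assms] by blast
  let ?D = "matrix3 1 0 0 0 (- 1) 0 0 0 1"
  let ?S = "B ** ?D ** matrix_inv B"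
  have D: "?D *v v = v - (2 * v $ 2) *s axis 2 1" for v
    by (simp add: vec_eq_iff forall_3 matrix_vector_mult_nth axis_def)
  have W: "weierstrass a b (?D *v u) = weierstrass a b u" for u
    by (simp add: weierstrass_def matrix_vector_mult_nth)
  have "invertible ?D" by (simp add: invertible_iff_det det_matrix3)
  have S: "?S *v v = B *v (?D *v (matrix_inv B *v v))" for v
    by (simp add: matrix_vector_mul_assoc matrix_mul_assoc)
  show ?thesis
  proof
    show "invertible ?S"
      using B(1) \<open>invertible ?D\<close> by (simp add: invertible_mult matrix_inv)
    fix v
    have "f (?S *v v) = weierstrass a b (matrix_inv B *v v)"
      unfolding S B(3) by (rule W)
    also have "\<dots> = f v" by (simp add: B(3)[symmetric] matrix_inv_vector B(1))
    finally show "f (?S *v v) = f v" .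
    show "?S *v v = v - (2 * (matrix_inv B *v v) $ 2) *s P"
      unfolding S D
      by (simp add: matrix_vector_mult_diff_distrib vector_scalar_commute B(1,2) matrix_inv_vector)
  next
    have "matrix_inv B *v P = axis 2 1" using B(1,2) matrix_inv_vector(2) by metis
    then show "?S *v P = - P"
      unfolding S by (simp add: D matrix_vector_mult_diff_distrib vector_scalar_commute B(2))
        (simp add: vec_eq_iff axis_def)
  qed
qed

end

section \<open>Existence of a flex\<close>

text \<open>The premise says that the resultant vanishes, i.e. the product of the values of the quadratic
  polynomial at the three roots of the depressed cubic.\<close>

lemma cubic_quadratic_common_root:
  fixes p q h0 h1 h2 :: complex
  assumes "h0 ^ 3 - 2 * p * h0\<^sup>2 * h2 + p * h0 * h1\<^sup>2 + 3 * q * h0 * h1 * h2 + p\<^sup>2 * h0 * h2\<^sup>2 -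
    q * h1 ^ 3 - p * q * h1 * h2\<^sup>2 + q\<^sup>2 * h2 ^ 3 = 0"
  obtains y where "y ^ 3 + p * y + q = 0" "h2 * y\<^sup>2 + h1 * y + h0 = 0"
proof -
  have "\<exists>y. poly [:q, p, 0, 1:] y = 0"
    by (rule alg_closed_imp_poly_has_root) simp
  then obtain a where a: "a ^ 3 + p * a + q = 0"
    by (auto simp: power3_eq_cube algebra_simps)
  \<comment> \<open>The quadratic is the quotient of the cubic by y - a. The third root
    \<open>c\<close> makes the sum of the roots 0, as there is no y^2 term.\<close>
  obtain b where b: "1 * b\<^sup>2 + a * b + (p + a\<^sup>2) = 0"
    using complex_quadratic_root[of 1 a "p + a\<^sup>2"] by auto
  define c where "c = - a - b"
  have p: "p = - (a\<^sup>2 + a * b + b\<^sup>2)" using b by algebra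
  have q: "q = - (a ^ 3) - p * a" using a by algebra
  have roots: "b ^ 3 + p * b + q = 0" "c ^ 3 + p * c + q = 0"
    unfolding q p c_def by algebra+
  have "(h2 * a\<^sup>2 + h1 * a + h0) * (h2 * b\<^sup>2 + h1 * b + h0) * (h2 * c\<^sup>2 + h1 * c + h0) = 0"
    unfolding assms[symmetric] c_def q p by algebra
  then show ?thesis using that a roots by auto
qed

text \<open>Without a zero, both dehomogenizations are polynomials without roots, hence constants,
  and they agree at (1, 1). Homogeneity between (2, 1) and (1, 1/2) then gives 2^n = 1.\<close>

lemma binary_form_zero:
  fixes N :: "complex \<Rightarrow> complex \<Rightarrow> complex" and p q :: "complex poly"
  assumes "\<And>x. N x 1 = poly p x" "\<And>z. N 1 z = poly q z"
    and hom: "\<And>t x z. N (t * x) (t * z) = t ^ n * N x z" and "n > 0"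
  obtains x z where "x \<noteq> 0 \<or> z \<noteq> 0" "N x z = 0"
proof (rule ccontr)
  assume "\<not> thesis"
  then have nz: "x \<noteq> 0 \<or> z \<noteq> 0 \<Longrightarrow> N x z \<noteq> 0" for x z using that by blast
  have "poly p x \<noteq> 0" "poly q x \<noteq> 0" for x using assms(1,2) nz by (metis one_neq_zero)+
  then have "degree p = 0" "degree q = 0"
    using alg_closed_imp_poly_has_root by blast+
  then obtain c d where "p = [:c:]" "q = [:d:]" by (metis degree_eq_zeroE)
  then have c: "N x 1 = c" and d: "N 1 z = d" for x z using assms(1,2) by simp_all
  have "N 2 1 = 2 ^ n * N 1 (1 / 2)" using hom[of 2 1 "1 / 2"] by simp
  moreover have "c = d" using c d by metis
  moreover have "c \<noteq> 0" using c nz by (metis one_neq_zero)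
  ultimately have "(2 :: complex) ^ n = 1" using c d by simp
  then have "(2 :: nat) ^ n = 1" by (metis of_nat_1 of_nat_eq_iff of_nat_numeral of_nat_power)
  then show False using \<open>n > 0\<close> by simp
qed

definition depressed ::
  "complex \<Rightarrow> complex \<Rightarrow> complex \<Rightarrow> complex \<Rightarrow> complex \<Rightarrow> complex \<Rightarrow> complex \<Rightarrow> complex ^ 3 \<Rightarrow> complex"
  where "depressed p0 p1 p2 q0 q1 q2 q3 v =
    1 * (v $ 2 * v $ 2 * v $ 2) + 3 * p0 * (v $ 1 * v $ 1 * v $ 2) + 6 * p1 * (v $ 1 * v $ 2 * v $ 3) +
    3 * p2 * (v $ 2 * v $ 3 * v $ 3) + q0 * (v $ 1 * v $ 1 * v $ 1) + 3 * q1 * (v $ 1 * v $ 1 * v $ 3) +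
    3 * q2 * (v $ 1 * v $ 3 * v $ 3) + q3 * (v $ 3 * v $ 3 * v $ 3)"

text \<open>One sixth of the matrix of second derivatives, i.e. the matrix of the bilinear form
  \<open>polar f v\<close>.\<close>

definition depressed_hessian ::
  "complex \<Rightarrow> complex \<Rightarrow> complex \<Rightarrow> complex \<Rightarrow> complex \<Rightarrow> complex \<Rightarrow> complex \<Rightarrow> complex ^ 3 \<Rightarrow> complex ^ 3 ^ 3"
  where "depressed_hessian p0 p1 p2 q0 q1 q2 q3 v = matrix3
    (p0 * v $ 2 + q0 * v $ 1 + q1 * v $ 3) (p0 * v $ 1 + p1 * v $ 3) (p1 * v $ 2 + q1 * v $ 1 + q2 * v $ 3)
    (p0 * v $ 1 + p1 * v $ 3) (v $ 2) (p1 * v $ 1 + p2 * v $ 3)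
    (p1 * v $ 2 + q1 * v $ 1 + q2 * v $ 3) (p1 * v $ 1 + p2 * v $ 3) (p2 * v $ 2 + q2 * v $ 1 + q3 * v $ 3)"

lemma polar_depressed:
  fixes p0 p1 p2 q0 q1 q2 q3 v
  defines "M \<equiv> depressed_hessian p0 p1 p2 q0 q1 q2 q3 v"
  shows "polar (depressed p0 p1 p2 q0 q1 q2 q3) v d w =
    w $ 1 * (M *v d) $ 1 + w $ 2 * (M *v d) $ 2 + w $ 3 * (M *v d) $ 3"
  unfolding depressed_def polar_add polar_cmult polar_monomial M_def depressed_hessian_def matrix_vector_mult_nth matrix3_nth
  by (simp add: field_simps)

text \<open>A zero of the Hessian on the curve is a flex: the kernel of the Hessian matrix at the
  point gives the direction of the flex tangent. Modulo the cubic, the Hessian is quadratic in \<open>y\<close>,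
  and the resultant is a form of degree 9 in \<open>x, z\<close>.\<close>

lemma depressed_has_flex:
  assumes "smooth_cubic (depressed p0 p1 p2 q0 q1 q2 q3)" (is "smooth_cubic ?g")
  obtains P where "is_flex ?g P"
proof -
  interpret smooth_cubic ?g by fact
  \<comment> \<open>\<open>A\<close>, \<open>B\<close>, \<open>C\<close>, \<open>L\<close>,
    \<open>M\<close> are the parts free of y in the entries of the Hessian matrix. In terms of them
    the cubic is y^3 + p y + q.\<close>
  define L where "L x z = p0 * x + p1 * z" for x z
  define M where "M x z = p1 * x + p2 * z" for x z
  define A where "A x z = q0 * x + q1 * z" for x z
  define B where "B x z = q1 * x + q2 * z" for x z
  define C where "C x z = q2 * x + q3 * z" for x z
  define p where "p x z = 3 * (L x z * x + M x z * z)" for x z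
  define q where "q x z = A x z * x\<^sup>2 + 2 * B x z * x * z + C x z * z\<^sup>2" for x z
  \<comment> \<open>\<open>D\<close> is the coefficient of y^3 in the Hessian determinant.
    Subtracting \<open>D\<close> times the cubic leaves h2 y^2 + h1 y + h0.\<close>
  define D where "D = p0 * p2 - p1\<^sup>2"
  define h2 where "h2 x z = p0 * C x z + p2 * A x z - 2 * p1 * B x z" for x z
  define h1 where "h1 x z = A x z * C x z - (B x z)\<^sup>2 - p0 * (M x z)\<^sup>2 - p2 * (L x z)\<^sup>2 +
    2 * p1 * L x z * M x z - D * p x z" for x z
  define h0 where "h0 x z = - A x z * (M x z)\<^sup>2 - C x z * (L x z)\<^sup>2 + 2 * B x z * L x z * M x z - D * q x z" for x z
  define N where "N x z = h0 x z ^ 3 - 2 * p x z * (h0 x z)\<^sup>2 * h2 x z + p x z * h0 x z * (h1 x z)\<^sup>2 +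
    3 * q x z * h0 x z * h1 x z * h2 x z + (p x z)\<^sup>2 * h0 x z * (h2 x z)\<^sup>2 -
    q x z * h1 x z ^ 3 - p x z * q x z * h1 x z * (h2 x z)\<^sup>2 + (q x z)\<^sup>2 * h2 x z ^ 3" for x z
  have poly: "\<exists>r. \<forall>x. poly r x = g x \<Longrightarrow> \<exists>r. \<forall>x. poly r x = h x \<Longrightarrow> \<exists>r. \<forall>x. poly r x = g x + h x"
     "\<exists>r. \<forall>x. poly r x = g x \<Longrightarrow> \<exists>r. \<forall>x. poly r x = h x \<Longrightarrow> \<exists>r. \<forall>x. poly r x = g x - h x"
     "\<exists>r. \<forall>x. poly r x = g x \<Longrightarrow> \<exists>r. \<forall>x. poly r x = h x \<Longrightarrow> \<exists>r. \<forall>x. poly r x = g x * h x"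
     "\<exists>r. \<forall>x. poly r x = g x \<Longrightarrow> \<exists>r. \<forall>x. poly r x = - g x"
     "\<exists>r. \<forall>x. poly r x = g x \<Longrightarrow> \<exists>r. \<forall>x. poly r x = g x ^ n"
     "\<exists>r. \<forall>x. poly r x = c" "\<exists>r. \<forall>x. poly r x = (x :: complex)"
     for g h :: "complex \<Rightarrow> complex" and n c
    by (metis poly_add, metis poly_diff, metis poly_mult, metis poly_minus, metis poly_power,
        rule exI[of _ "[:c:]"], simp, rule exI[of _ "[:0, 1:]"], simp)
  have "\<exists>r. \<forall>x. poly r x = N x 1"
    unfolding N_def h0_def h1_def h2_def p_def q_def A_def B_def C_def L_def M_def by (intro poly)
  moreover have "\<exists>r. \<forall>z. poly r z = N 1 z"
    unfolding N_def h0_def h1_def h2_def p_def q_def A_def B_def C_def L_def M_def by (intro poly)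
  \<comment> \<open>The degrees of h2, h1, h0, p, q are 1, 2, 3, 2, 3, which gives every term of
    \<open>N\<close> degree 9.\<close>
  moreover have "N (t * x) (t * z) = t ^ 9 * N x z" for t x z
  proof -
    have lin: "L (t * x) (t * z) = t * L x z" "M (t * x) (t * z) = t * M x z"
      "A (t * x) (t * z) = t * A x z" "B (t * x) (t * z) = t * B x z" "C (t * x) (t * z) = t * C x z"
      by (simp_all add: L_def M_def A_def B_def C_def algebra_simps)
    have pq: "p (t * x) (t * z) = t\<^sup>2 * p x z" "q (t * x) (t * z) = t ^ 3 * q x z"
      unfolding p_def q_def lin by algebra+
    have hs: "h2 (t * x) (t * z) = t * h2 x z" "h1 (t * x) (t * z) = t\<^sup>2 * h1 x z"
      "h0 (t * x) (t * z) = t ^ 3 * h0 x z"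
      unfolding h0_def h1_def h2_def lin pq by algebra+
    show ?thesis
      unfolding N_def pq hs by algebra
  qed
  ultimately obtain x z where xz: "x \<noteq> 0 \<or> z \<noteq> 0" "N x z = 0"
    using binary_form_zero[of N _ _ 9] by (metis zero_less_numeral)
  obtain y where y: "y ^ 3 + p x z * y + q x z = 0" "h2 x z * y\<^sup>2 + h1 x z * y + h0 x z = 0"
    using cubic_quadratic_common_root xz(2) unfolding N_def by metis
  let ?v = "vector [x, y, z] :: complex ^ 3"
  let ?M = "matrix3 (p0 * y + q0 * x + q1 * z) (p0 * x + p1 * z) (p1 * y + q1 * x + q2 * z)
    (p0 * x + p1 * z) y (p1 * x + p2 * z) (p1 * y + q1 * x + q2 * z) (p1 * x + p2 * z) (p2 * y + q2 * x + q3 * z)"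
  have v: "?v \<noteq> 0" using xz(1) by (auto simp: vec_eq_iff forall_3)
  have g: "?g ?v = 0"
    using y(1) unfolding depressed_def p_def q_def A_def B_def C_def L_def M_def vector_3 by algebra
  have "det ?M = (h2 x z * y\<^sup>2 + h1 x z * y + h0 x z) + D * (y ^ 3 + p x z * y + q x z)"
    unfolding det_matrix3 h0_def h1_def h2_def D_def p_def q_def A_def B_def C_def L_def M_def by algebra
  then have "det ?M = 0" using y by simp
  then have "\<not> (\<exists>B. B ** ?M = mat 1)"
    using invertible_iff_det invertible_left_inverse by blast
  then obtain d where d: "?M *v d = 0" "d \<noteq> 0"
    using matrix_left_invertible_ker by blast
  then have ker: "polar ?g ?v d w = 0" for w
    by (simp add: polar_depressed depressed_hessian_def)
  \<comment> \<open>A kernel vector proportional to the point would make the point singular.\<close>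
  have "d \<noteq> s *s ?v" for s
  proof
    assume s: "d = s *s ?v"
    then have "s \<noteq> 0" using d(2) by auto
    then have "polar ?g ?v ?v w = 0" for w
      using ker[of w] unfolding s by (simp add: trilinear)
    then show False using smooth v by blast
  qed
  moreover have "polar ?g ?v ?v d = 0" using ker polar_commute2 by metis
  ultimately show ?thesis using that[of ?v] v g ker by (auto simp: is_flex_def)
qed

lemma (in smooth_cubic) flex_exists:
  obtains P where "is_flex f P"
proof -
  obtain e0 where e0: "f e0 \<noteq> 0"
  proof (rule ccontr)
    assume "\<not> thesis"
    then have "f v = 0" for v using that by blast
    then have "polar f v v w = 0" for v w by (simp add: polar_def)
    then have "axis 1 1 = (0 :: complex ^ 3)" using smooth by blast
    then show False by (simp add: axis_eq_0_iff)
  qed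
  obtain r where r: "r ^ 3 = 1 / f e0" using exists_complex_root[of 3] by (metis zero_neq_numeral)
  define e where "e = r *s e0"
  have fe: "f e = 1" using e0 by (simp add: e_def scale r)
  then have "e \<noteq> 0" using scale[of 0 0] by auto
  then obtain b c where bc: "invertible (cols b e c)" by (rule extend_basis1)
  \<comment> \<open>The shift of y by s x + t z cancels the terms x y^2 and y^2 z, because
    \<open>f e = 1\<close>.\<close>
  define s where "s = - polar f b e e"
  define t where "t = - polar f e e c"
  have "equiv_at e f (\<lambda>x y z. f (x *s b + y *s e + z *s c))"
    unfolding equiv_at_def by (intro exI[of _ "cols b e c"]) (simp add: bc cols_mult axis_def)
  then have "equiv_at e f (\<lambda>x y z. f (x *s b + (s * x + y + t * z) *s e + z *s c))"
    by (rule equiv_at_subst[of _ _ _ 1 1 _ 0 s t]) simp_all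
  then obtain B :: "complex ^ 3 ^ 3" where B: "invertible B"
    "\<And>v. f (B *v v) = f (v $ 1 *s b + (s * v $ 1 + v $ 2 + t * v $ 3) *s e + v $ 3 *s c)"
    by (auto simp: equiv_at_def)
  define p0 where "p0 = polar f b b e - s\<^sup>2"
  define p1 where "p1 = polar f b e c - s * t"
  define p2 where "p2 = polar f e c c - t\<^sup>2"
  define q0 where "q0 = f b + 3 * s * polar f b b e - 2 * s ^ 3"
  define q1 where "q1 = polar f b b c + t * polar f b b e + 2 * s * polar f b e c - 2 * s\<^sup>2 * t"
  define q2 where "q2 = polar f b c c + s * polar f e c c + 2 * t * polar f b e c - 2 * s * t\<^sup>2"
  define q3 where "q3 = f c + 3 * t * polar f e c c - 2 * t ^ 3"
  have be: "polar f b e e = - s" "polar f e e c = - t" by (simp_all add: s_def t_def)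
  have "f (B *v v) = depressed p0 p1 p2 q0 q1 q2 q3 v" for v
    unfolding B(2) expand be fe depressed_def p0_def p1_def p2_def q0_def q1_def q2_def q3_def by algebra
  then have eq: "(\<lambda>v. f (B *v v)) = depressed p0 p1 p2 q0 q1 q2 q3" by auto
  then have "lin_equiv f (depressed p0 p1 p2 q0 q1 q2 q3)"
    using B(1) unfolding lin_equiv_def by (metis)
  then have "smooth_cubic (depressed p0 p1 p2 q0 q1 q2 q3)"
    using smooth_cubic_lin_equiv smooth_cubic_axioms by blast
  then obtain P where "is_flex (\<lambda>v. f (B *v v)) P"
    using depressed_has_flex eq by metis
  then show ?thesis using that is_flex_compose B(1) by blast
qed

section \<open>Singular cubics\<close>

text \<open>Induction over the three nested levels, innermost first; each level provides the
  coefficients for the next.\<close>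

lemma polynomial_fun_compose_matrix:
  assumes "polynomial_fun g"
  shows "polynomial_fun (\<lambda>v. g ((A :: complex ^ 3 ^ 3) *v v))"
proof -
  have z: "polynomial_fun (\<lambda>v. eval3 [:[:c:]:] (A *v v))" for c
  proof (induction c)
    case (pCons c p)
    have "(\<lambda>v. eval3 [:[:pCons c p:]:] (A *v v)) =
        (\<lambda>v. c + (A *v v) $ 3 * eval3 [:[:p:]:] (A *v v))"
      by (simp add: eval3_def fun_eq_iff)
    then show ?case
      using pCons.IH by (auto intro!: polynomial_fun_add polynomial_fun_mult polynomial_fun_matrix_coord)
  qed (simp add: eval3_def polynomial_fun_const)
  have y: "polynomial_fun (\<lambda>v. eval3 [:c:] (A *v v))" for c
  proof (induction c)
    case (pCons c p)
    have "(\<lambda>v. eval3 [:pCons c p:] (A *v v)) =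
        (\<lambda>v. eval3 [:[:c:]:] (A *v v) + (A *v v) $ 2 * eval3 [:p:] (A *v v))"
      by (simp add: eval3_def fun_eq_iff)
    then show ?case
      using pCons.IH z[of c] by (auto intro!: polynomial_fun_add polynomial_fun_mult polynomial_fun_matrix_coord)
  qed (simp add: eval3_def polynomial_fun_const)
  have "polynomial_fun (\<lambda>v. eval3 G (A *v v))" for G
  proof (induction G)
    case (pCons c p)
    have "(\<lambda>v. eval3 (pCons c p) (A *v v)) =
        (\<lambda>v. eval3 [:c:] (A *v v) + (A *v v) $ 1 * eval3 p (A *v v))"
      by (simp add: eval3_def fun_eq_iff)
    then show ?case
      using pCons.IH y[of c] by (auto intro!: polynomial_fun_add polynomial_fun_mult polynomial_fun_matrix_coord)
  qed (simp add: eval3_def polynomial_fun_const)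
  then show ?thesis using assms by (auto simp: polynomial_fun_def)
qed

text \<open>Reducibility phrased for functions is invariant under linear equivalence, so
  irreducibility of \<open>F\<close> can be used on its normal forms.\<close>

definition has_factor :: "(complex ^ 3 \<Rightarrow> complex) \<Rightarrow> bool" where
  "has_factor f \<longleftrightarrow> (\<exists>g h. polynomial_fun g \<and> polynomial_fun h \<and> g 0 = 0 \<and> h 0 = 0 \<and> (\<forall>v. f v = g v * h v))"

lemma has_factorI:
  assumes "polynomial_fun g" "polynomial_fun h" "g 0 = 0" "h 0 = 0" "\<And>v. f v = g v * h v"
  shows "has_factor f"
  using assms unfolding has_factor_def by blast

lemma has_factor_lin_equiv:
  assumes "has_factor g" "lin_equiv f g"
  shows "has_factor f"
proof -
  obtain A where A: "invertible A" "\<And>v. g v = f (A *v v)"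
    using assms(2) by (auto simp: lin_equiv_def)
  obtain k h where kh: "polynomial_fun k" "polynomial_fun h" "k 0 = 0" "h 0 = 0" "\<And>v. g v = k v * h v"
    using assms(1) by (auto simp: has_factor_def)
  have "f v = k (matrix_inv A *v v) * h (matrix_inv A *v v)" for v
    using kh(5)[of "matrix_inv A *v v"] by (simp add: A matrix_inv_vector)
  then show ?thesis
    using kh by (intro has_factorI[OF polynomial_fun_compose_matrix[OF kh(1)] polynomial_fun_compose_matrix[OF kh(2)]]) auto
qed

lemma irreducible_not_has_factor: "irreducible F \<Longrightarrow> \<not> has_factor (eval3 F)"
  unfolding has_factor_def using irreducible_no_factor by blast

lemma polynomial_fun_diff:
  assumes "polynomial_fun g" "polynomial_fun h"
  shows "polynomial_fun (\<lambda>v. g v - h v)"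
  using polynomial_fun_add[OF assms(1) polynomial_fun_mult[OF polynomial_fun_const[of "- 1"] assms(2)]]
  by simp

lemmas polynomial_fun_intros = polynomial_fun_add polynomial_fun_diff polynomial_fun_mult polynomial_fun_const polynomial_fun_coord

text \<open>The general cubic with a singular point at \<open>(0 : 0 : 1)\<close>.\<close>

definition pinched ::
  "complex \<Rightarrow> complex \<Rightarrow> complex \<Rightarrow> complex \<Rightarrow> complex \<Rightarrow> complex \<Rightarrow> complex \<Rightarrow> complex ^ 3 \<Rightarrow> complex"
  where "pinched c0 c1 c2 c3 q0 q1 q2 v =
    c0 * v $ 1 ^ 3 + c1 * (v $ 1)\<^sup>2 * v $ 2 + c2 * v $ 1 * (v $ 2)\<^sup>2 + c3 * v $ 2 ^ 3 +
    (q0 * (v $ 1)\<^sup>2 + q1 * v $ 1 * v $ 2 + q2 * (v $ 2)\<^sup>2) * v $ 3"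

text \<open>With \<open>S\<close> as third basis vector, the coefficients of z^3, x z^2 and y z^2
  are multiples of values \<open>polar f S S w\<close>.\<close>

lemma (in cubic_form) singular_lin_equiv_pinched:
  assumes "S \<noteq> 0" "\<And>w. polar f S S w = 0"
  obtains c0 c1 c2 c3 q0 q1 q2 where "lin_equiv f (pinched c0 c1 c2 c3 q0 q1 q2)"
proof -
  obtain b c where bc: "invertible (cols b c S)"
    using extend_basis1[OF assms(1)] cols_swap by metis
  have "polar f b S S = 0" "polar f c S S = 0" "f S = 0"
    using assms(2) by (metis polar_commute polar_commute2 diagonal)+
  then have "f (cols b c S *v v) = pinched (f b) (3 * polar f b b c) (3 * polar f b c c) (f c)
      (3 * polar f b b S) (6 * polar f b c S) (3 * polar f c c S) v" for v
    unfolding cols_mult expand pinched_def by (simp add: algebra_simps)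
  then show ?thesis using that bc unfolding lin_equiv_def by metis
qed

text \<open>A substitution in x and y alone. The quadratic part, which decides the type of the
  singularity, is tracked explicitly; the binary cubic is left open.\<close>

lemma pinched_subst:
  assumes "a * d \<noteq> b * c"
  obtains c0' c1' c2' c3' where
    "lin_equiv (pinched c0 c1 c2 c3 q0 q1 q2) (pinched c0' c1' c2' c3' (q0 * a\<^sup>2 + q1 * a * c + q2 * c\<^sup>2)
      (2 * q0 * a * b + q1 * (a * d + b * c) + 2 * q2 * c * d) (q0 * b\<^sup>2 + q1 * b * d + q2 * d\<^sup>2))"
proof
  show "lin_equiv (pinched c0 c1 c2 c3 q0 q1 q2) (pinched
      (c0 * a ^ 3 + c1 * a\<^sup>2 * c + c2 * a * c\<^sup>2 + c3 * c ^ 3)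
      (3 * c0 * a\<^sup>2 * b + c1 * (a\<^sup>2 * d + 2 * a * b * c) + c2 * (2 * a * c * d + b * c\<^sup>2) + 3 * c3 * c\<^sup>2 * d)
      (3 * c0 * a * b\<^sup>2 + c1 * (b\<^sup>2 * c + 2 * a * b * d) + c2 * (2 * b * c * d + a * d\<^sup>2) + 3 * c3 * c * d\<^sup>2)
      (c0 * b ^ 3 + c1 * b\<^sup>2 * d + c2 * b * d\<^sup>2 + c3 * d ^ 3)
      (q0 * a\<^sup>2 + q1 * a * c + q2 * c\<^sup>2)
      (2 * q0 * a * b + q1 * (a * d + b * c) + 2 * q2 * c * d) (q0 * b\<^sup>2 + q1 * b * d + q2 * d\<^sup>2))"
  proof (rule lin_equiv_matrix3[of _ _ a b 0 c d 0 0 0 1])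
    show "a * (d * 1 - 0 * 0) - b * (c * 1 - 0 * 0) + 0 * (c * 0 - d * 0) \<noteq> 0" using assms by simp
  qed (simp only: pinched_def matrix_vector_mult_nth matrix3_nth, algebra)
qed

text \<open>The column (a, c) is a zero of the form. If there is a second zero, (b, d) is a multiple
  of it and the form becomes xy; otherwise the form is a multiple of a square and becomes
  -y^2.\<close>

lemma binary_quadratic_normal_form:
  fixes q0 q1 q2 :: complex
  assumes "q0 \<noteq> 0 \<or> q1 \<noteq> 0 \<or> q2 \<noteq> 0"
  obtains a b c d where "a * d \<noteq> b * c"
    "q0 * a\<^sup>2 + q1 * a * c + q2 * c\<^sup>2 = 0"
    "(2 * q0 * a * b + q1 * (a * d + b * c) + 2 * q2 * c * d, q0 * b\<^sup>2 + q1 * b * d + q2 * d\<^sup>2) \<in> {(1, 0), (0, -1)}"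
proof (cases "q0 = 0")
  case True
  show ?thesis
  proof (cases "q1 = 0")
    case True
    with \<open>q0 = 0\<close> have "q2 \<noteq> 0" using assms by simp
    obtain s where s: "s\<^sup>2 = - 1 / q2" using exists_complex_root[of 2] by (metis zero_neq_numeral)
    with \<open>q2 \<noteq> 0\<close> have "s \<noteq> 0" by auto
    then show ?thesis
      \<comment> \<open>The values here and below are listed in the order a, d, b, c, in which the
        variables occur in the first condition.\<close>
      by (intro that[of 1 s 0 0]) (use s \<open>q2 \<noteq> 0\<close> True \<open>q0 = 0\<close> in simp_all)
  next
    case False
    show ?thesis
      by (rule that[of "1 / q1" 1 "- q2 / q1" 0])
        (use False True in \<open>auto simp: field_simps power2_eq_square\<close>)
  qed
next
  case False
  obtain r where r: "q0 * r\<^sup>2 + q1 * r + q2 = 0" using complex_quadratic_root[OF False] by blast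
  define t where "t = - q1 / q0 - r"
  have q1: "q1 = - q0 * (r + t)" using False by (simp add: t_def field_simps)
  have q2: "q2 = q0 * r * t" using r unfolding q1 by algebra
  show ?thesis
  proof (cases "r = t")
    case True
    obtain s where s: "s\<^sup>2 = - 1 / q0" using exists_complex_root[of 2] by (metis zero_neq_numeral)
    with False have "s \<noteq> 0" by auto
    show ?thesis
    proof (rule that[of r 0 s 1])
      have "q0 * s\<^sup>2 = - 1" using s False by simp
      then show "(2 * q0 * r * s + q1 * (r * 0 + s * 1) + 2 * q2 * 1 * 0, q0 * s\<^sup>2 + q1 * s * 0 + q2 * 0\<^sup>2) \<in> {(1, 0), (0, -1)}"
        by (simp add: q1 True)
    qed (use \<open>s \<noteq> 0\<close> True in \<open>simp_all add: q1 q2 algebra_simps power2_eq_square\<close>)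
  next
    case False
    \<comment> \<open>The second zero is (t, 1). With (b, d) = k (t, 1) the mixed coefficient is -k
      q0 (r - t)^2, which has to be 1.\<close>
    define k where "k = - 1 / (q0 * (r - t)\<^sup>2)"
    have k: "k * q0 * (r - t)\<^sup>2 = - 1" using False \<open>q0 \<noteq> 0\<close> by (simp add: k_def)
    then have "k \<noteq> 0" by auto
    show ?thesis
    proof (rule that[of r k "k * t" 1])
      show "r * k \<noteq> k * t * 1" using False \<open>k \<noteq> 0\<close> by simp
      have "2 * q0 * r * (k * t) + q1 * (r * k + k * t * 1) + 2 * q2 * 1 * k = - (k * q0 * (r - t)\<^sup>2)"
        unfolding q1 q2 by algebra
      moreover have "q0 * (k * t)\<^sup>2 + q1 * (k * t) * k + q2 * k\<^sup>2 = 0"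
        unfolding q1 q2 by algebra
      ultimately show "(2 * q0 * r * (k * t) + q1 * (r * k + k * t * 1) + 2 * q2 * 1 * k,
          q0 * (k * t)\<^sup>2 + q1 * (k * t) * k + q2 * k\<^sup>2) \<in> {(1, 0), (0, -1)}"
        by (simp add: k)
    qed (simp add: q1 q2 algebra_simps power2_eq_square)
  qed
qed

text \<open>Without quadratic part this is a binary cubic, which has a linear factor over the
  complex numbers.\<close>

lemma pinched_cone_has_factor: "has_factor (pinched c0 c1 c2 c3 0 0 0)"
proof (cases "c0 = 0")
  case True
  show ?thesis
    by (rule has_factorI[of "\<lambda>v. v $ 2" "\<lambda>v. c1 * (v $ 1 * v $ 1) + c2 * (v $ 1 * v $ 2) + c3 * (v $ 2 * v $ 2)"])
      (auto simp: True pinched_def algebra_simps power2_eq_square power3_eq_cube intro!: polynomial_fun_intros)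
next
  case False
  have "\<exists>r. poly [:c3, c2, c1, c0:] r = 0"
    by (rule alg_closed_imp_poly_has_root) (simp add: False)
  then obtain r where r: "c3 = - (r * (c2 + r * (c1 + r * c0)))"
    by (auto simp: eq_neg_iff_add_eq_0)
  show ?thesis
    by (rule has_factorI[of "\<lambda>v. v $ 1 + (- r) * v $ 2"
        "\<lambda>v. c0 * (v $ 1 * v $ 1) + (c1 + c0 * r) * (v $ 1 * v $ 2) + (c2 + c1 * r + c0 * r * r) * (v $ 2 * v $ 2)"])
      (auto simp: r pinched_def algebra_simps power2_eq_square power3_eq_cube intro!: polynomial_fun_intros)
qed

definition node :: "complex ^ 3 \<Rightarrow> complex" where
  "node v = v $ 1 ^ 3 + v $ 2 ^ 3 + v $ 1 * v $ 2 * v $ 3"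

text \<open>The tangents at the node are x - y and x + y, taken as new coordinates up to the factor
  1/2. The 3 in the last row cancels the x y^2 produced by the sum of cubes.\<close>

lemma lin_equiv_node: "lin_equiv node (\<lambda>v. (v $ 1)\<^sup>2 * (v $ 1 + v $ 3) - (v $ 2)\<^sup>2 * v $ 3)"
  by (rule lin_equiv_matrix3[of _ _ "1 / 2" "- 1 / 2" 0 "1 / 2" "1 / 2" 0 3 0 4])
    (simp_all add: node_def matrix_vector_mult_nth field_simps power2_eq_square power3_eq_cube)

text \<open>If \<open>c0\<close> or \<open>c3\<close> is 0, then y or x is a factor. Otherwise x^2 y
  and x y^2 are absorbed into z through xyz, and x, y are scaled with z compensating.\<close>

lemma pinched_node:
  assumes "\<not> has_factor (pinched c0 c1 c2 c3 0 1 0)"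
  shows "lin_equiv (pinched c0 c1 c2 c3 0 1 0) node"
proof -
  have "c0 \<noteq> 0"
  proof
    assume c: "c0 = 0"
    have "has_factor (pinched c0 c1 c2 c3 0 1 0)"
      by (rule has_factorI[of "\<lambda>v. v $ 2" "\<lambda>v. c1 * (v $ 1 * v $ 1) + c2 * (v $ 1 * v $ 2) + c3 * (v $ 2 * v $ 2) + v $ 1 * v $ 3"])
        (auto simp: c pinched_def algebra_simps power2_eq_square power3_eq_cube intro!: polynomial_fun_intros)
    with assms show False by contradiction
  qed
  moreover have "c3 \<noteq> 0"
  proof
    assume c: "c3 = 0"
    have "has_factor (pinched c0 c1 c2 c3 0 1 0)"
      by (rule has_factorI[of "\<lambda>v. v $ 1" "\<lambda>v. c0 * (v $ 1 * v $ 1) + c1 * (v $ 1 * v $ 2) + c2 * (v $ 2 * v $ 2) + v $ 2 * v $ 3"])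
        (auto simp: c pinched_def algebra_simps power2_eq_square power3_eq_cube intro!: polynomial_fun_intros)
    with assms show False by contradiction
  qed
  moreover obtain r s where rs: "r ^ 3 = 1 / c0" "s ^ 3 = 1 / c3"
    using exists_complex_root[of 3] by (metis zero_neq_numeral)
  ultimately have nz: "r \<noteq> 0" "s \<noteq> 0" "c0 * r ^ 3 = 1" "c3 * s ^ 3 = 1" by auto
  show ?thesis
  proof (rule lin_equiv_matrix3[of _ _ r 0 0 0 s 0 "- c1 * r" "- c2 * s" "1 / (r * s)"])
    fix v
    have "pinched c0 c1 c2 c3 0 1 0 (matrix3 r 0 0 0 s 0 (- c1 * r) (- c2 * s) (1 / (r * s)) *v v) =
      (c0 * r ^ 3) * v $ 1 ^ 3 + (c3 * s ^ 3) * v $ 2 ^ 3 + v $ 1 * v $ 2 * v $ 3"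
      using nz(1,2) by (simp add: pinched_def matrix_vector_mult_nth field_simps power2_eq_square power3_eq_cube)
    then show "node v = pinched c0 c1 c2 c3 0 1 0 (matrix3 r 0 0 0 s 0 (- c1 * r) (- c2 * s) (1 / (r * s)) *v v)"
      unfolding nz node_def by simp
  qed (use nz in simp)
qed

text \<open>If \<open>c0\<close> is 0, then y is a factor. Otherwise completing the cube removes x^2
  y (this is \<open>k\<close>), and y^2 z absorbs x y^2 and y^3 (these are \<open>m\<close> and
  \<open>n\<close>).\<close>

lemma pinched_cusp:
  assumes "\<not> has_factor (pinched c0 c1 c2 c3 0 0 (- 1))"
  shows "lin_equiv (pinched c0 c1 c2 c3 0 0 (- 1)) (\<lambda>v. v $ 1 ^ 3 - (v $ 2)\<^sup>2 * v $ 3)"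
proof -
  have "c0 \<noteq> 0"
  proof
    assume c: "c0 = 0"
    have "has_factor (pinched c0 c1 c2 c3 0 0 (- 1))"
      by (rule has_factorI[of "\<lambda>v. v $ 2" "\<lambda>v. c1 * (v $ 1 * v $ 1) + c2 * (v $ 1 * v $ 2) + c3 * (v $ 2 * v $ 2) + (- 1) * (v $ 2 * v $ 3)"])
        (auto simp: c pinched_def algebra_simps power2_eq_square power3_eq_cube intro!: polynomial_fun_intros)
    with assms show False by contradiction
  qed
  moreover obtain r where "r ^ 3 = 1 / c0"
    using exists_complex_root[of 3] by (metis zero_neq_numeral)
  ultimately have r: "r \<noteq> 0" "c0 * r ^ 3 = 1" by auto
  define k where "k = c1 / (3 * c0)"
  have c1: "c1 = 3 * c0 * k" using \<open>c0 \<noteq> 0\<close> by (simp add: k_def)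
  define m where "m = r * (3 * c0 * k\<^sup>2 - 2 * c1 * k + c2)"
  define n where "n = - c0 * k ^ 3 + c1 * k\<^sup>2 - c2 * k + c3"
  show ?thesis
  proof (rule lin_equiv_matrix3[of _ _ r "- k" 0 0 1 0 m n 1])
    fix v
    have "pinched c0 c1 c2 c3 0 0 (- 1) (matrix3 r (- k) 0 0 1 0 m n 1 *v v) =
      (c0 * r ^ 3) * v $ 1 ^ 3 - (v $ 2)\<^sup>2 * v $ 3"
      unfolding pinched_def matrix_vector_mult_nth matrix3_nth m_def n_def c1 by algebra
    then show "v $ 1 ^ 3 - (v $ 2)\<^sup>2 * v $ 3 = pinched c0 c1 c2 c3 0 0 (- 1) (matrix3 r (- k) 0 0 1 0 m n 1 *v v)"
      unfolding r by simp
  qed (use r in simp)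
qed

lemma singular_classification:
  assumes "cubic_form f" "\<not> has_factor f" "S \<noteq> 0" "\<And>w. polar f S S w = 0"
  shows "lin_equiv f (\<lambda>v. v $ 1 ^ 3 - (v $ 2)\<^sup>2 * v $ 3) \<or> lin_equiv f node"
proof -
  interpret cubic_form f by fact
  obtain c0 c1 c2 c3 q0 q1 q2 where p: "lin_equiv f (pinched c0 c1 c2 c3 q0 q1 q2)"
    using singular_lin_equiv_pinched assms by blast
  have "q0 \<noteq> 0 \<or> q1 \<noteq> 0 \<or> q2 \<noteq> 0"
    using p pinched_cone_has_factor has_factor_lin_equiv assms(2) by blast
  then obtain a b c d where abcd: "a * d \<noteq> b * c" "q0 * a\<^sup>2 + q1 * a * c + q2 * c\<^sup>2 = 0"
    "(2 * q0 * a * b + q1 * (a * d + b * c) + 2 * q2 * c * d, q0 * b\<^sup>2 + q1 * b * d + q2 * d\<^sup>2) \<in> {(1, 0), (0, -1)}"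
    by (rule binary_quadratic_normal_form)
  obtain c0' c1' c2' c3' where "lin_equiv f (pinched c0' c1' c2' c3' 0
      (2 * q0 * a * b + q1 * (a * d + b * c) + 2 * q2 * c * d) (q0 * b\<^sup>2 + q1 * b * d + q2 * d\<^sup>2))"
    using pinched_subst[OF abcd(1)] lin_equiv_trans[OF p] abcd(2) by metis
  then consider "lin_equiv f (pinched c0' c1' c2' c3' 0 1 0)" | "lin_equiv f (pinched c0' c1' c2' c3' 0 0 (- 1))"
    using abcd(3) by auto
  then show ?thesis
    using pinched_node pinched_cusp assms(2) has_factor_lin_equiv lin_equiv_trans by cases blast+
qed

section \<open>Symmetry groups\<close>

definition syms :: "(complex ^ 3 \<Rightarrow> complex) \<Rightarrow> (complex ^ 3 ^ 3) set" where
  "syms f = {A. invertible A \<and> (\<forall>v. f (A *v v) = f v)}"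

lemma symmetry_group_eq_syms: "symmetry_group F = syms (eval3 F)"
  by (simp add: symmetry_group_def syms_def GL3_def)

lemma syms_mult: "A \<in> syms f \<Longrightarrow> B \<in> syms f \<Longrightarrow> A ** B \<in> syms f"
  by (simp add: syms_def invertible_mult matrix_vector_mul_assoc[symmetric])

lemma syms_inverse: "A \<in> syms f \<Longrightarrow> matrix_inv A \<in> syms f"
  by (auto simp: syms_def matrix_inv) (metis matrix_inv_vector(1))

lemma polar_syms: "A \<in> syms f \<Longrightarrow> polar f (A *v u) (A *v v) (A *v w) = polar f u v w"
  using polar_compose_matrix[of f A u v w] by (simp add: syms_def)

lemma is_flex_syms: "A \<in> syms f \<Longrightarrow> is_flex f P \<Longrightarrow> is_flex f (A *v P)"
  using is_flex_compose[of A f P] by (simp add: syms_def)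

lemma conjugate_cancel:
  fixes A :: "complex ^ 3 ^ 3"
  assumes "invertible A"
  shows "matrix_inv A ** (A ** B ** matrix_inv A) ** A = B"
    and "A ** (matrix_inv A ** B ** A) ** matrix_inv A = B"
proof -
  have "matrix_inv A ** (A ** B ** matrix_inv A) ** A = (matrix_inv A ** A) ** B ** (matrix_inv A ** A)"
    by (simp only: matrix_mul_assoc)
  then show "matrix_inv A ** (A ** B ** matrix_inv A) ** A = B"
    by (simp add: matrix_inv assms)
  have "A ** (matrix_inv A ** B ** A) ** matrix_inv A = (A ** matrix_inv A) ** B ** (A ** matrix_inv A)"
    by (simp only: matrix_mul_assoc)
  then show "A ** (matrix_inv A ** B ** A) ** matrix_inv A = B"
    by (simp add: matrix_inv assms)
qed

lemma syms_conjugate: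
  assumes "invertible A" "\<And>v. g v = f (A *v v)"
  shows "syms f = (\<lambda>B. A ** B ** matrix_inv A) ` syms g"
proof -
  have 1: "A ** B ** matrix_inv A \<in> syms f" if "B \<in> syms g" for B
  proof -
    have "f (A *v (B *v (matrix_inv A *v v))) = f v" for v
    proof -
      have "f (A *v (B *v (matrix_inv A *v v))) = g (matrix_inv A *v v)"
        using that by (simp add: syms_def assms(2)[symmetric])
      then show ?thesis by (simp add: assms(2) matrix_inv_vector assms(1))
    qed
    then show ?thesis
      using that assms(1) by (simp add: syms_def invertible_mult matrix_inv matrix_vector_mul_assoc matrix_mul_assoc)
  qed
  have 2: "matrix_inv A ** B ** A \<in> syms g" if "B \<in> syms f" for B
  proof -
    have "g (matrix_inv A *v (B *v (A *v v))) = g v" for v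
      using that by (simp add: syms_def assms(2) matrix_inv_vector assms(1))
    then show ?thesis
      using that assms(1) by (simp add: syms_def invertible_mult matrix_inv matrix_vector_mul_assoc matrix_mul_assoc)
  qed
  show ?thesis
  proof (intro equalityI subsetI)
    fix B assume "B \<in> syms f"
    then show "B \<in> (\<lambda>B. A ** B ** matrix_inv A) ` syms g"
      using 2 conjugate_cancel(2)[OF assms(1), of B] by (metis image_eqI)
  qed (use 1 in auto)
qed

lemma inj_conjugate:
  fixes A :: "complex ^ 3 ^ 3"
  shows "invertible A \<Longrightarrow> inj (\<lambda>B. A ** B ** matrix_inv A)"
  by (rule inj_on_inverseI[of _ "\<lambda>B. matrix_inv A ** B ** A"]) (rule conjugate_cancel(1))

lemma card_syms_lin_equiv:
  assumes "lin_equiv f g"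
  shows "card (syms f) = card (syms g)" "finite (syms f) \<longleftrightarrow> finite (syms g)"
proof -
  obtain A where A: "invertible A" "\<And>v. g v = f (A *v v)"
    using assms by (auto simp: lin_equiv_def)
  have "inj_on (\<lambda>B. A ** B ** matrix_inv A) (syms g)"
    using inj_conjugate[OF A(1)] inj_on_subset by blast
  then show "card (syms f) = card (syms g)" "finite (syms f) \<longleftrightarrow> finite (syms g)"
    unfolding syms_conjugate[of A g f, OF A] by (simp_all add: card_image finite_image_iff)
qed

lemma proj_class_eq: "proj_class A = {mat c ** A | c. c \<noteq> 0}"
  by (auto simp: proj_class_def r_coset_def scalars_def GL3_def)

lemma proj_class_eq_iff: "proj_class A = proj_class B \<longleftrightarrow> (\<exists>c. c \<noteq> 0 \<and> A = mat c ** B)"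
proof
  assume "proj_class A = proj_class B"
  moreover have "A \<in> proj_class A"
    unfolding proj_class_eq by (rule CollectI, rule exI[of _ 1]) simp
  ultimately show "\<exists>c. c \<noteq> 0 \<and> A = mat c ** B" by (auto simp: proj_class_eq)
next
  assume "\<exists>c. c \<noteq> 0 \<and> A = mat c ** B"
  then obtain c where c: "c \<noteq> 0" "A = mat c ** B" by auto
  have "mat d ** A = mat (d * c) ** B" for d
    by (simp add: c(2) matrix_mul_assoc mat_mult_mat)
  moreover have "mat d ** B = mat (d / c) ** A" for d
    by (simp add: c matrix_mul_assoc mat_mult_mat)
  ultimately show "proj_class A = proj_class B"
    unfolding proj_class_eq using c(1) by (metis (no_types, opaque_lifting) divide_eq_0_iff mult_eq_0_iff)
qed

lemma mat_mult_vector: "(mat c ** (A :: complex ^ 3 ^ 3)) *v v = c *s (A *v v)"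
  by (simp add: vec_eq_iff matrix_vector_mult_nth mat_mult_entry algebra_simps)

lemma mat_mult_syms:
  assumes "cubic_form f" "w ^ 3 = 1" "A \<in> syms f"
  shows "mat w ** A \<in> syms f"
proof -
  have "w \<noteq> 0" using assms(2) by auto
  then show ?thesis
    using assms cubic_form.scale[OF assms(1)]
    by (auto simp: syms_def mat_mult_vector invertible_mat invertible_mult)
qed

lemma card_cube_roots_unity: "card {w :: complex. w ^ 3 = 1} = 3" "finite {w :: complex. w ^ 3 = 1}"
  using card_roots_unity_eq[of 3] finite_roots_unity[of 3] by auto

text \<open>Evaluating at \<open>e\<close> shows that two proportional symmetries differ by a cube
  root of unity, and every such scalar occurs; so all fibres of \<open>proj_class\<close> have three
  elements.\<close>

lemma card_syms_projective:
  assumes "cubic_form f" "f e \<noteq> 0" "finite (syms f)"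
  shows "card (syms f) = 3 * card (proj_class ` syms f)"
proof -
  have "card {B \<in> syms f. proj_class B = y} = 3" if "y \<in> proj_class ` syms f" for y
  proof -
    obtain A where A: "A \<in> syms f" "y = proj_class A"
      using \<open>y \<in> proj_class ` syms f\<close> by blast
    have w: "c ^ 3 = 1" if "mat c ** A \<in> syms f" for c
    proof -
      have "f e = f (c *s (A *v e))" using that by (simp add: syms_def flip: mat_mult_vector)
      also have "\<dots> = c ^ 3 * f e" using A(1) by (simp add: cubic_form.scale[OF assms(1)] syms_def)
      finally show ?thesis using assms(2) by simp
    qed
    have "{B \<in> syms f. proj_class B = y} = (\<lambda>c. mat c ** A) ` {c. c ^ 3 = 1}"
    proof (intro equalityI subsetI)
      fix B assume "B \<in> {B \<in> syms f. proj_class B = y}"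
      then show "B \<in> (\<lambda>c. mat c ** A) ` {c. c ^ 3 = 1}"
        using w unfolding A(2) proj_class_eq_iff by blast
    next
      fix B assume "B \<in> (\<lambda>c. mat c ** A) ` {c. c ^ 3 = 1}"
      then obtain c where c: "c ^ 3 = 1" "B = mat c ** A" by auto
      then have "c \<noteq> 0" by auto
      then show "B \<in> {B \<in> syms f. proj_class B = y}"
        using c mat_mult_syms[OF assms(1) _ A(1)] unfolding A(2) by (auto simp: proj_class_eq_iff)
    qed
    moreover have "inj (\<lambda>c. mat c ** A)"
    proof (rule injI)
      fix c d assume "mat c ** A = mat d ** A"
      then have "c *s (A *v (matrix_inv A *v axis 1 1)) = d *s (A *v (matrix_inv A *v axis 1 1))"
        by (metis mat_mult_vector)
      then have "c *s (axis 1 1 :: complex ^ 3) = d *s axis 1 1"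
        using A(1) by (simp only: syms_def mem_Collect_eq matrix_inv_vector)
      then have "(c *s (axis 1 1 :: complex ^ 3)) $ 1 = (d *s axis 1 1) $ 1" by simp
      then show "c = d" by (simp add: axis_def)
    qed
    ultimately show ?thesis
      by (simp add: card_image inj_on_subset card_cube_roots_unity)
  qed
  then have "(\<Sum>y\<in>proj_class ` syms f. card {B \<in> syms f. proj_class B = y}) = 3 * card (proj_class ` syms f)"
    by simp
  then show ?thesis
    using sum.image_gen[OF assms(3), of "\<lambda>_. 1 :: nat" proj_class] by simp
qed

section \<open>Symmetry groups of the cusp and the node\<close>

definition diag3 :: "complex \<Rightarrow> complex \<Rightarrow> complex \<Rightarrow> complex ^ 3 ^ 3" where
  "diag3 a b c = matrix3 a 0 0 0 b 0 0 0 c"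

text \<open>The symmetries of a singular cubic fix the singular point, here \<open>(0 : 0 : 1)\<close>.\<close>

lemma syms_singular_point:
  assumes "cubic_form f" "A \<in> syms f"
    and sing: "\<And>v. (\<forall>w. polar f v v w = 0) \<longleftrightarrow> v $ 1 = 0 \<and> v $ 2 = 0"
  shows "A $ 1 $ 3 = 0" "A $ 2 $ 3 = 0"
proof -
  have "polar f (A *v axis 3 1) (A *v axis 3 1) w = 0" for w
  proof -
    have "polar f (A *v axis 3 1) (A *v axis 3 1) (A *v (matrix_inv A *v w)) = 0"
      unfolding polar_syms[OF assms(2)] using sing[of "axis 3 1"] by (simp add: axis_def)
    then show ?thesis using assms(2) by (simp add: syms_def matrix_inv_vector)
  qed
  then show "A $ 1 $ 3 = 0" "A $ 2 $ 3 = 0"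
    using sing[of "A *v axis 3 1"] by (simp_all add: matrix_vector_mult_nth axis_def)
qed

definition cusp :: "complex ^ 3 \<Rightarrow> complex" where
  "cusp v = v $ 1 ^ 3 - (v $ 2)\<^sup>2 * v $ 3"

lemma polar_cusp:
  "polar cusp v v w = (v $ 1)\<^sup>2 * w $ 1 - (2 * v $ 2 * v $ 3 * w $ 2 + (v $ 2)\<^sup>2 * w $ 3) / 3"
proof -
  have eq: "cusp = (\<lambda>v. v $ 1 * v $ 1 * v $ 1 - v $ 2 * v $ 2 * v $ 3)"
    by (simp add: cusp_def fun_eq_iff power2_eq_square power3_eq_cube)
  show ?thesis
    by (subst eq, unfold polar_diff polar_monomial) (simp add: field_simps power2_eq_square)
qed

lemma cubic_form_cusp: "cubic_form cusp"
proof -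
  have eq: "cusp = (\<lambda>v. v $ 1 * v $ 1 * v $ 1 - v $ 2 * v $ 2 * v $ 3)"
    by (simp add: cusp_def fun_eq_iff power2_eq_square power3_eq_cube)
  show ?thesis by (subst eq) (intro cubic_form_intros)
qed

text \<open>Cube roots of unity preserve every cubic form, so the genuine group contains their
  scalar multiples of the one-parameter family; projectively they add nothing.\<close>

lemma syms_cusp: "syms cusp = {mat \<omega> ** cusp_matrix \<alpha> | \<omega> \<alpha>. \<omega> ^ 3 = 1 \<and> \<alpha> \<noteq> 0}"
proof -
  have m: "mat \<omega> ** cusp_matrix \<alpha> = diag3 \<omega> (\<omega> * \<alpha>) (\<omega> / \<alpha>\<^sup>2)" for \<omega> \<alpha>
    by (rule matrix3_eqI) (simp_all add: mat_mult_entry cusp_matrix_def diag3_def)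
  have "A \<in> syms cusp" if "\<omega> ^ 3 = 1" "\<alpha> \<noteq> 0" "A = mat \<omega> ** cusp_matrix \<alpha>" for A \<omega> \<alpha>
  proof -
    have "\<omega> \<noteq> 0" using that(1) by auto
    have "cusp (A *v v) = \<omega> ^ 3 * cusp v" for v
      using that(2) unfolding that(3) m cusp_def
      by (simp add: matrix_vector_mult_nth diag3_def field_simps power2_eq_square power3_eq_cube)
    then show ?thesis
      using that \<open>\<omega> \<noteq> 0\<close> unfolding syms_def that(3) m
      by (simp add: invertible_iff_det diag3_def det_matrix3)
  qed
  moreover have "\<exists>\<omega> \<alpha>. \<omega> ^ 3 = 1 \<and> \<alpha> \<noteq> 0 \<and> A = mat \<omega> ** cusp_matrix \<alpha>" if A: "A \<in> syms cusp" for A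
  proof -
    have sing: "(\<forall>w. polar cusp v v w = 0) \<longleftrightarrow> v $ 1 = 0 \<and> v $ 2 = 0" for v
    proof
      assume *: "\<forall>w. polar cusp v v w = 0"
      show "v $ 1 = 0 \<and> v $ 2 = 0"
        using *[rule_format, of "axis 1 1"] *[rule_format, of "axis 3 1"]
        by (simp add: polar_cusp axis_def)
    qed (simp add: polar_cusp)
    note z = syms_singular_point[OF cubic_form_cusp A sing]
    define a where "a = A $ 1 $ 1"
    define d where "d = A $ 1 $ 2"
    define e where "e = A $ 2 $ 1"
    define b where "b = A $ 2 $ 2"
    define p where "p = A $ 3 $ 1"
    define q where "q = A $ 3 $ 2"
    define c where "c = A $ 3 $ 3"
    have *: "(a * x + d * y) ^ 3 - (e * x + b * y)\<^sup>2 * (p * x + q * y + c * z) = x ^ 3 - y\<^sup>2 * z" for x y z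
    proof -
      have "cusp (A *v vector [x, y, z]) = cusp (vector [x, y, z])" using A by (simp add: syms_def)
      then show ?thesis
        by (simp add: cusp_def matrix_vector_mult_nth z a_def b_def c_def d_def e_def p_def q_def)
    qed
    \<comment> \<open>Comparison of the coefficients of z.\<close>
    have c: "(e * x + b * y)\<^sup>2 * c = y\<^sup>2" for x y
      using *[of x y 1] *[of x y 0] by (simp add: algebra_simps)
    have bc: "b\<^sup>2 * c = 1" using c[of 0 1] by simp
    then have "e = 0" using c[of 1 0] by auto
    have **: "(a * x + d * y) ^ 3 - (b * y)\<^sup>2 * (p * x + q * y) = x ^ 3" for x y
      using *[of x y 0] \<open>e = 0\<close> by simp
    have a3: "a ^ 3 = 1" using **[of 1 0] by simp
    \<comment> \<open>The second difference in x over 0, 1, 2 at y = 1 annihilates the linear terms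
      and leaves 6 a^3 + 6 a^2 d.\<close>
    have "6 * (a\<^sup>2 * d) = ((a * 2 + d * 1) ^ 3 - (b * 1)\<^sup>2 * (p * 2 + q * 1)) - 2 * ((a * 1 + d * 1) ^ 3 - (b * 1)\<^sup>2 * (p * 1 + q * 1)) +
        ((a * 0 + d * 1) ^ 3 - (b * 1)\<^sup>2 * (p * 0 + q * 1)) - 6 * a ^ 3"
      by algebra
    also have "\<dots> = 0" unfolding ** a3 by simp
    finally have "d = 0" using a3 by auto
    then have "b\<^sup>2 * (p * x + q) = 0" for x
      using **[of x 1] a3 by (simp add: power_mult_distrib)
    moreover have "b \<noteq> 0" using bc by auto
    ultimately have "p * x + q = 0" for x by simp
    from this[of 0] this[of 1] have "p = 0" "q = 0" by auto
    have "a \<noteq> 0" using a3 by auto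
    \<comment> \<open>Dividing diag(a, b, 1/b^2) by a gives the parameter b/a; the last entry fits
      because a^3 = 1.\<close>
    have "A = mat a ** cusp_matrix (b / a)"
      unfolding m using z \<open>d = 0\<close> \<open>e = 0\<close> \<open>p = 0\<close> \<open>q = 0\<close> \<open>a \<noteq> 0\<close> \<open>b \<noteq> 0\<close> bc a3
      by (intro matrix3_eqI)
        (simp_all add: diag3_def a_def[symmetric] b_def[symmetric] c_def[symmetric] d_def[symmetric]
          e_def[symmetric] p_def[symmetric] q_def[symmetric] field_simps power2_eq_square power3_eq_cube)
    moreover have "b / a \<noteq> 0" using \<open>a \<noteq> 0\<close> \<open>b \<noteq> 0\<close> by simp
    ultimately show ?thesis using a3 by blast
  qed
  ultimately show ?thesis by blast
qed

lemma polar_node: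
  "polar node v v w = ((3 * (v $ 1)\<^sup>2 + v $ 2 * v $ 3) * w $ 1 + (3 * (v $ 2)\<^sup>2 + v $ 1 * v $ 3) * w $ 2 +
    v $ 1 * v $ 2 * w $ 3) / 3"
proof -
  have eq: "node = (\<lambda>v. v $ 1 * v $ 1 * v $ 1 + v $ 2 * v $ 2 * v $ 2 + v $ 1 * v $ 2 * v $ 3)"
    by (simp add: node_def fun_eq_iff power3_eq_cube)
  show ?thesis
    by (subst eq, unfold polar_add polar_monomial) (simp add: field_simps power2_eq_square)
qed

lemma cubic_form_node: "cubic_form node"
proof -
  have eq: "node = (\<lambda>v. v $ 1 * v $ 1 * v $ 1 + v $ 2 * v $ 2 * v $ 2 + v $ 1 * v $ 2 * v $ 3)"
    by (simp add: node_def fun_eq_iff power3_eq_cube)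
  show ?thesis by (subst eq) (intro cubic_form_intros)
qed

text \<open>A symmetry fixes the node and preserves its tangent cone xy up to a factor, so it keeps
  or swaps the lines x = 0 and y = 0. The absence of x^2 y and x y^2 then clears the last
  row.\<close>

lemma syms_node:
  "syms node = (\<lambda>(a, b, s). if s then matrix3 0 a 0 b 0 0 0 0 (1 / (a * b)) else diag3 a b (1 / (a * b))) `
     ({a. a ^ 3 = 1} \<times> {b. b ^ 3 = 1} \<times> UNIV)" (is "_ = ?\<phi> ` ?S")
proof (intro equalityI subsetI)
  fix A assume "A \<in> ?\<phi> ` ?S"
  then obtain a b s where ab: "a ^ 3 = 1" "b ^ 3 = 1" "A = ?\<phi> (a, b, s)" by auto
  then have "a \<noteq> 0" "b \<noteq> 0" by auto
  have "det A \<noteq> 0"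
    using \<open>a \<noteq> 0\<close> \<open>b \<noteq> 0\<close> unfolding ab(3) by (cases s) (simp_all add: det_matrix3 diag3_def)
  moreover have "node (A *v v) = node v" for v
    using \<open>a \<noteq> 0\<close> \<open>b \<noteq> 0\<close> ab(1,2) unfolding ab(3)
    by (cases s) (simp_all add: node_def diag3_def matrix_vector_mult_nth power_mult_distrib)
  ultimately show "A \<in> syms node" by (simp add: syms_def invertible_iff_det)
next
  fix A assume A: "A \<in> syms node"
  have sing: "(\<forall>w. polar node v v w = 0) \<longleftrightarrow> v $ 1 = 0 \<and> v $ 2 = 0" for v
  proof
    assume *: "\<forall>w. polar node v v w = 0"
    have "v $ 1 * v $ 2 = 0" "3 * (v $ 1)\<^sup>2 + v $ 2 * v $ 3 = 0" "3 * (v $ 2)\<^sup>2 + v $ 1 * v $ 3 = 0"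
      using *[rule_format, of "axis 3 1"] *[rule_format, of "axis 1 1"] *[rule_format, of "axis 2 1"]
      by (simp_all add: polar_node axis_def)
    then show "v $ 1 = 0 \<and> v $ 2 = 0" by auto
  qed (simp add: polar_node)
  note z = syms_singular_point[OF cubic_form_node A sing]
  define a where "a = A $ 1 $ 1"
  define d where "d = A $ 1 $ 2"
  define e where "e = A $ 2 $ 1"
  define b where "b = A $ 2 $ 2"
  define p where "p = A $ 3 $ 1"
  define q where "q = A $ 3 $ 2"
  define c where "c = A $ 3 $ 3"
  note defs = a_def b_def c_def d_def e_def p_def q_def
  have *: "(a * x + d * y) ^ 3 + (e * x + b * y) ^ 3 + (a * x + d * y) * (e * x + b * y) * (p * x + q * y + c * z)
      = x ^ 3 + y ^ 3 + x * y * z" for x y z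
  proof -
    have "node (A *v vector [x, y, z]) = node (vector [x, y, z])" using A by (simp add: syms_def)
    then show ?thesis by (simp add: node_def matrix_vector_mult_nth z defs)
  qed
  have c: "(a * x + d * y) * (e * x + b * y) * c = x * y" for x y
    using *[of x y 1] *[of x y 0] by (simp add: algebra_simps)
  have "c \<noteq> 0" using c[of 1 1] by auto
  then have ae: "a * e = 0" "d * b = 0" using c[of 1 0] c[of 0 1] by auto
  have abde: "(a * b + d * e) * c = 1"
  proof -
    have "(a * b + d * e) * c = (a * 1 + d * 1) * (e * 1 + b * 1) * c - (a * e) * c - (d * b) * c"
      by algebra
    also have "\<dots> = 1" unfolding ae c by simp
    finally show ?thesis .
  qed
  \<comment> \<open>The part with z = 0, multiplied by \<open>c\<close> so that the product of the
    two linear forms becomes xy.\<close>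
  have pq: "(p * x + q * y) * x * y = c * ((x ^ 3 + y ^ 3) - (a * x + d * y) ^ 3 - (e * x + b * y) ^ 3)" for x y
    using *[of x y 0] c[of x y] by algebra
  consider "a \<noteq> 0" "e = 0" "d = 0" | "a = 0" "e \<noteq> 0" "b = 0"
    using ae abde by (cases "a = 0"; cases "e = 0"; cases "d = 0") auto
  then show "A \<in> ?\<phi> ` ?S"
  proof cases
    case 1
    then have "b \<noteq> 0" using abde by auto
    have a3: "a ^ 3 = 1" "b ^ 3 = 1" using pq[of 1 0] pq[of 0 1] 1 \<open>c \<noteq> 0\<close> by simp_all
    then have "(p * x + q * y) * x * y = 0" for x y using pq[of x y] 1 by (simp add: power_mult_distrib)
    from this[of 1 1] this[of 1 "- 1"] have "p = 0 \<and> q = 0" by algebra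
    then have "A = diag3 a b (1 / (a * b))"
      using 1 z abde \<open>b \<noteq> 0\<close>
      by (intro matrix3_eqI) (simp_all add: diag3_def field_simps flip: defs)
    then show ?thesis using a3 by (intro image_eqI[of _ _ "(a, b, False)"]) auto
  next
    case 2
    then have "d \<noteq> 0" using abde by auto
    have a3: "e ^ 3 = 1" "d ^ 3 = 1" using pq[of 1 0] pq[of 0 1] 2 \<open>c \<noteq> 0\<close> by simp_all
    then have "(p * x + q * y) * x * y = 0" for x y using pq[of x y] 2 by (simp add: power_mult_distrib)
    from this[of 1 1] this[of 1 "- 1"] have "p = 0 \<and> q = 0" by algebra
    then have "A = matrix3 0 d 0 e 0 0 0 0 (1 / (d * e))"
      using 2 z abde \<open>d \<noteq> 0\<close>
      by (intro matrix3_eqI) (simp_all add: field_simps flip: defs)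
    then show ?thesis using a3 by (intro image_eqI[of _ _ "(d, e, True)"]) auto
  qed
qed

lemma card_syms_node: "card (syms node) = 18" "finite (syms node)"
proof -
  let ?\<phi> = "\<lambda>(a, b, s). if s then matrix3 0 a 0 b 0 0 0 0 (1 / (a * b)) else diag3 a b (1 / (a * b))"
  let ?S = "{a :: complex. a ^ 3 = 1} \<times> {b :: complex. b ^ 3 = 1} \<times> (UNIV :: bool set)"
  have "inj_on ?\<phi> ?S"
  proof (rule inj_onI)
    fix x y assume xy: "x \<in> ?S" "y \<in> ?S" "?\<phi> x = ?\<phi> y"
    obtain a b s where x: "x = (a, b, s)" by (cases x)
    obtain a' b' s' where y: "y = (a', b', s')" by (cases y)
    have nz: "a \<noteq> 0" "a' \<noteq> 0" "b \<noteq> 0" "b' \<noteq> 0" using xy x y by auto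
    have "?\<phi> x $ i $ j = ?\<phi> y $ i $ j" for i j using xy(3) by simp
    from this[of 1 1] this[of 1 2] this[of 2 1] this[of 2 2]
    show "x = y" using nz unfolding x y by (auto simp: diag3_def split: if_splits)
  qed
  then have "card (?\<phi> ` ?S) = card ?S" by (rule card_image)
  then show "card (syms node) = 18" "finite (syms node)"
    unfolding syms_node using card_cube_roots_unity by (simp_all add: card_cartesian_product)
qed

section \<open>Symmetries of Weierstrass cubics\<close>

lemma weierstrass_sum:
  "weierstrass a b = (\<lambda>v. v $ 1 * v $ 1 * v $ 1 + a * (v $ 1 * v $ 3 * v $ 3) +
     b * (v $ 3 * v $ 3 * v $ 3) - v $ 2 * v $ 2 * v $ 3)"
  by (simp add: weierstrass_def fun_eq_iff power2_eq_square power3_eq_cube)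

lemma cubic_form_weierstrass: "cubic_form (weierstrass a b)"
  by (subst weierstrass_sum) (intro cubic_form_intros)

lemma polar_weierstrass:
  "polar (weierstrass a b) v v w =
     ((3 * (v $ 1)\<^sup>2 + a * (v $ 3)\<^sup>2) * w $ 1 - 2 * v $ 2 * v $ 3 * w $ 2 +
      (2 * a * v $ 1 * v $ 3 + 3 * b * (v $ 3)\<^sup>2 - (v $ 2)\<^sup>2) * w $ 3) / 3"
  "polar (weierstrass a b) v w w =
     ((3 * (w $ 1)\<^sup>2 + a * (w $ 3)\<^sup>2) * v $ 1 - 2 * w $ 2 * w $ 3 * v $ 2 +
      (2 * a * w $ 1 * w $ 3 + 3 * b * (w $ 3)\<^sup>2 - (w $ 2)\<^sup>2) * v $ 3) / 3"
  by (subst weierstrass_sum, unfold polar_add polar_diff polar_cmult polar_monomial,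
      simp add: field_simps power2_eq_square)+

text \<open>The third division polynomial of \<open>y\<^sup>2 = g(x)\<close>, where \<open>g(x) = x\<^sup>3 + a x + b\<close>, is
  \<open>2 g g'' - g'\<^sup>2\<close>; its roots are the abscissae of the finite flexes.\<close>

definition division3 :: "complex \<Rightarrow> complex \<Rightarrow> complex poly" where
  "division3 a b = [:- a\<^sup>2, 12 * b, 6 * a, 0, 3:]"

lemma poly_division3:
  "poly (division3 a b) x = 12 * x * (x ^ 3 + a * x + b) - (3 * x\<^sup>2 + a)\<^sup>2"
  by (simp add: division3_def algebra_simps power2_eq_square power3_eq_cube)

lemma poly_pderiv_division3: "poly (pderiv (division3 a b)) x = 12 * (x ^ 3 + a * x + b)"
  by (simp add: division3_def pderiv_pCons algebra_simps power3_eq_cube)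

text \<open>One normalized vector per projective point, so that counting vectors counts
  flexes.\<close>

definition flex_points :: "complex \<Rightarrow> complex \<Rightarrow> (complex ^ 3) set" where
  "flex_points a b = insert (axis 2 1)
     {vector [x, y, 1] | x y. poly (division3 a b) x = 0 \<and> y\<^sup>2 = x ^ 3 + a * x + b}"

text \<open>Otherwise g(x) = x^3 + a x + b has a double root x, and (x : 0 : 1) is singular; the
  derivative in z vanishes there because 2 a x + 3 b = 3 g - x g'.\<close>

lemma division3_root_nonzero:
  assumes "smooth_cubic (weierstrass a b)" "poly (division3 a b) x = 0"
  shows "x ^ 3 + a * x + b \<noteq> 0"
proof
  assume g: "x ^ 3 + a * x + b = 0"
  with assms(2) have g': "3 * x\<^sup>2 + a = 0" by (simp add: poly_division3)
  have "2 * a * x + 3 * b = 3 * (x ^ 3 + a * x + b) - x * (3 * x\<^sup>2 + a)" by algebra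
  then have "2 * a * x + 3 * b = 0" using g g' by simp
  then have "polar (weierstrass a b) (vector [x, 0, 1]) (vector [x, 0, 1]) w = 0" for w
    using g' by (simp add: polar_weierstrass)
  then have "vector [x, 0, 1] = (0 :: complex ^ 3)" using smooth_cubic.smooth[OF assms(1)] by blast
  then show False by (simp add: vec_eq_iff forall_3)
qed

text \<open>The derivative of the quartic is 12 g, so a multiple root would be a root of g, which
  the preceding lemma excludes.\<close>

lemma card_division3_roots:
  assumes "smooth_cubic (weierstrass a b)"
  shows "card {x. poly (division3 a b) x = 0} = 4" "finite {x. poly (division3 a b) x = 0}"
proof -
  let ?p = "division3 a b"
  have nz: "?p \<noteq> 0" by (simp add: division3_def)
  have "rsquarefree ?p"
    unfolding rsquarefree_roots using division3_root_nonzero[OF assms] by (auto simp: poly_pderiv_division3 simp del: distrib_left_numeral)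
  then have "?p = smult (lead_coeff ?p) (\<Prod>z | poly ?p z = 0. [:- z, 1:])"
    by (simp add: complex_poly_decompose_rsquarefree)
  then have "degree ?p = degree (\<Prod>z | poly ?p z = 0. [:- z, 1:])"
    using nz by (metis degree_smult_eq leading_coeff_0_iff)
  also have "\<dots> = card {x. poly ?p x = 0}"
    by (subst degree_prod_sum_eq) simp_all
  finally have "card {x. poly ?p x = 0} = degree ?p" by simp
  then show "card {x. poly ?p x = 0} = 4" by (simp add: division3_def)
  show "finite {x. poly ?p x = 0}" using poly_roots_finite[OF nz] .
qed

text \<open>Each of the four abscissae carries two ordinates, as g is nonzero there; the point at
  infinity is the ninth.\<close>

lemma card_flex_points:
  assumes "smooth_cubic (weierstrass a b)"
  shows "card (flex_points a b) = 9" "finite (flex_points a b)"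
proof -
  let ?R = "{x. poly (division3 a b) x = 0}"
  let ?Y = "\<lambda>x. {y. y\<^sup>2 = x ^ 3 + a * x + b}"
  let ?\<phi> = "\<lambda>(x, y). vector [x, y, 1] :: complex ^ 3"
  have Y: "card (?Y x) = 2 \<and> finite (?Y x)" if "x \<in> ?R" for x
    using card_nth_roots[of "x ^ 3 + a * x + b" 2] finite_nth_roots[of 2 "x ^ 3 + a * x + b"]
      division3_root_nonzero[OF assms, of x] that by auto
  have "inj ?\<phi>" by (auto simp: inj_def vec_eq_iff forall_3)
  have "card (Sigma ?R ?Y) = (\<Sum>x\<in>?R. card (?Y x))"
    by (rule card_SigmaI) (use card_division3_roots[OF assms] Y in auto)
  also have "\<dots> = (\<Sum>x\<in>?R. 2)" using Y by (intro sum.cong) auto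
  also have "\<dots> = 8" using card_division3_roots[OF assms] by simp
  finally have "card (?\<phi> ` Sigma ?R ?Y) = 8"
    using \<open>inj ?\<phi>\<close> by (simp add: card_image inj_on_subset)
  moreover have fin: "finite (?\<phi> ` Sigma ?R ?Y)"
    using card_division3_roots[OF assms] Y by (intro finite_imageI finite_SigmaI) auto
  moreover have "flex_points a b = insert (axis 2 1) (?\<phi> ` Sigma ?R ?Y)"
    unfolding flex_points_def by (auto simp: image_iff)
  moreover have "axis 2 1 \<notin> ?\<phi> ` Sigma ?R ?Y"
    by (auto simp: vec_eq_iff forall_3 axis_def)
  ultimately show "card (flex_points a b) = 9" "finite (flex_points a b)" by simp_all
qed

lemma flex_points_nonzero: "P \<in> flex_points a b \<Longrightarrow> P \<noteq> 0"
  by (auto simp: flex_points_def vec_eq_iff forall_3 axis_def)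

lemma flex_points_eq_if_proportional:
  assumes "P \<in> flex_points a b" "Q \<in> flex_points a b" "P = c *s Q"
  shows "P = Q"
proof -
  have "P $ 3 = c * Q $ 3" "P $ 2 = c * Q $ 2" using assms(3) by auto
  then have "c = 1" using assms(1,2) by (auto simp: flex_points_def axis_def assms(3) vec_eq_iff forall_3)
  then show ?thesis using assms(3) by simp
qed

lemma is_flex_weierstrass_infinity: "is_flex (weierstrass a b) (axis 2 1)"
  unfolding is_flex_def
proof (intro conjI exI[of _ "axis 1 1"] allI)
  fix s :: complex
  show "axis 1 1 \<noteq> s *s (axis 2 1 :: complex ^ 3)" by (simp add: vec_eq_iff forall_3 axis_def)
qed (simp_all add: polar_weierstrass weierstrass_def axis_def vec_eq_iff forall_3)

lemma is_flex_flex_points: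
  assumes "smooth_cubic (weierstrass a b)" "P \<in> flex_points a b"
  shows "is_flex (weierstrass a b) P"
proof (cases "P = axis 2 1")
  case True
  then show ?thesis by (simp add: is_flex_weierstrass_infinity)
next
  case False
  then obtain x y where xy: "P = vector [x, y, 1]" "poly (division3 a b) x = 0" "y\<^sup>2 = x ^ 3 + a * x + b"
    using assms(2) by (auto simp: flex_points_def)
  have "y \<noteq> 0" using division3_root_nonzero[OF assms(1) xy(2)] xy(3) by auto
  \<comment> \<open>The direction (2 y, g'(x), 0) is tangent to y^2 = g(x); the second-order
    condition along it is the division polynomial.\<close>
  show ?thesis
    unfolding is_flex_def
  proof (intro conjI exI[of _ "vector [2 * y, 3 * x\<^sup>2 + a, 0]"] allI)
    show "P \<noteq> 0" using assms(2) by (rule flex_points_nonzero)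
    show "weierstrass a b P = 0" by (simp add: xy weierstrass_def)
    show "vector [2 * y, 3 * x\<^sup>2 + a, 0] \<noteq> s *s P" for s
      using \<open>y \<noteq> 0\<close> by (auto simp: xy(1) vec_eq_iff forall_3)
    show "polar (weierstrass a b) P P (vector [2 * y, 3 * x\<^sup>2 + a, 0]) = 0"
      by (simp add: polar_weierstrass xy(1))
    have "3 * (2 * y)\<^sup>2 * x - (3 * x\<^sup>2 + a)\<^sup>2 = poly (division3 a b) x"
      unfolding poly_division3 xy(3)[symmetric] by algebra
    then show "polar (weierstrass a b) P (vector [2 * y, 3 * x\<^sup>2 + a, 0]) (vector [2 * y, 3 * x\<^sup>2 + a, 0]) = 0"
      by (simp add: polar_weierstrass xy(1,2))
  qed
qed

lemma flex_proportional_flex_points: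
  assumes "is_flex (weierstrass a b) P"
  obtains c Q where "c \<noteq> 0" "Q \<in> flex_points a b" "P = c *s Q"
proof (cases "P $ 3 = 0")
  case True
  have "weierstrass a b P = 0" "P \<noteq> 0" using assms by (auto simp: is_flex_def)
  then have "P $ 1 = 0" "P $ 2 \<noteq> 0" using True by (auto simp: weierstrass_def vec_eq_iff forall_3)
  then show ?thesis
    using that[of "P $ 2" "axis 2 1"] True by (simp add: flex_points_def vec_eq_iff forall_3 axis_def)
next
  case False
  interpret cubic_form "weierstrass a b" by (rule cubic_form_weierstrass)
  define x where "x = P $ 1 / P $ 3"
  define y where "y = P $ 2 / P $ 3"
  let ?Q = "vector [x, y, 1] :: complex ^ 3"
  have PQ: "P = P $ 3 *s ?Q" using False by (simp add: x_def y_def vec_eq_iff forall_3)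
  then have "?Q = (1 / P $ 3) *s P" using False by (simp add: vec_eq_iff forall_3)
  then have Q: "is_flex (weierstrass a b) ?Q" using is_flex_scale[OF assms] False by simp
  then obtain d where d: "\<And>s. d \<noteq> s *s ?Q" "polar (weierstrass a b) ?Q ?Q d = 0"
    "polar (weierstrass a b) ?Q d d = 0"
    by (auto simp: is_flex_def)
  have fQ: "weierstrass a b ?Q = 0" using Q by (simp add: is_flex_def)
  then have y2: "y\<^sup>2 = x ^ 3 + a * x + b" by (simp add: weierstrass_def)
  \<comment> \<open>\<open>u\<close> is the intersection of the flex tangent with the line z =
    0.\<close>
  define u where "u = d - d $ 3 *s ?Q"
  have u_alt: "u = d + (- d $ 3) *s ?Q" by (simp add: u_def vec_eq_iff)
  have dQ: "polar (weierstrass a b) ?Q d ?Q = 0"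
    using d(2) polar_commute2 by metis
  have "polar (weierstrass a b) ?Q ?Q u = 0" "polar (weierstrass a b) ?Q u u = 0"
    unfolding u_alt by (simp_all only: trilinear d(2,3) dQ diagonal fQ) simp_all
  moreover have u3: "u $ 3 = 0" by (simp add: u_def)
  ultimately have eqs: "(3 * x\<^sup>2 + a) * u $ 1 = 2 * y * u $ 2" "3 * (u $ 1)\<^sup>2 * x = (u $ 2)\<^sup>2"
    by (simp_all add: polar_weierstrass)
  have "u $ 1 \<noteq> 0"
  proof
    assume "u $ 1 = 0"
    then have "u = 0" using eqs(2) u3 by (simp add: vec_eq_iff forall_3)
    then show False using d(1)[of "d $ 3"] by (simp add: u_def)
  qed
  \<comment> \<open>Elimination of the second coordinate of \<open>u\<close> from the two tangency
    equations.\<close>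
  have "poly (division3 a b) x * (u $ 1)\<^sup>2 = 4 * y\<^sup>2 * (3 * (u $ 1)\<^sup>2 * x) - ((3 * x\<^sup>2 + a) * u $ 1)\<^sup>2"
    unfolding poly_division3 y2 by algebra
  also have "\<dots> = 0" unfolding eqs by algebra
  finally have "poly (division3 a b) x = 0" using \<open>u $ 1 \<noteq> 0\<close> by simp
  then have "?Q \<in> flex_points a b" using y2 by (auto simp: flex_points_def)
  then show ?thesis using that PQ False by blast
qed

text \<open>The flex \<open>P = (x : y : 1)\<close> lies on a line with \<open>R = (x : -y : 1)\<close> and \<open>(0 : 1 : 0)\<close>, and the
  involution at the flex \<open>R\<close> exchanges the other two.\<close>

lemma syms_transitive:
  assumes sm: "smooth_cubic (weierstrass a b)" and "P \<in> flex_points a b"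
  obtains S c where "S \<in> syms (weierstrass a b)" "c \<noteq> 0" "S *v axis 2 1 = c *s P"
proof (cases "P = axis 2 1")
  case True
  show ?thesis
    by (rule that[of "mat 1" 1]) (simp_all add: True syms_def invertible_mat)
next
  case False
  interpret smooth_cubic "weierstrass a b" by (rule sm)
  obtain x y where xy: "P = vector [x, y, 1]" "poly (division3 a b) x = 0" "y\<^sup>2 = x ^ 3 + a * x + b"
    using assms(2) False by (auto simp: flex_points_def)
  have "y \<noteq> 0" using division3_root_nonzero[OF assms(1) xy(2)] xy(3) by auto
  define R :: "complex ^ 3" where "R = vector [x, - y, 1]"
  have "R \<in> flex_points a b" 
    unfolding flex_points_def by (rule insertI2, rule CollectI) (metis R_def power2_minus xy(2,3))
  then have "is_flex (weierstrass a b) R" using is_flex_flex_points assms(1) by blast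
  then obtain S :: "complex ^ 3 ^ 3" and l where S: "invertible S" "\<And>v. weierstrass a b (S *v v) = weierstrass a b v"
    "\<And>v. S *v v = v - l v *s R" "S *v R = - R"
    by (rule flex_involution) (rule that)
  let ?O = "axis 2 1 :: complex ^ 3"
  have Ss: "S \<in> syms (weierstrass a b)" using S by (simp add: syms_def)
  \<comment> \<open>If \<open>S\<close> fixed (0, 1, 0), invariance of the polar value at (O, O, R)
    would make it 0, as \<open>S\<close> negates \<open>R\<close>; but it is -1/3.\<close>
  have "l ?O \<noteq> 0"
  proof
    assume "l ?O = 0"
    then have "S *v ?O = ?O" using S(3) by simp
    then have "polar (weierstrass a b) ?O ?O R = polar (weierstrass a b) ?O ?O ((- 1) *s R)"
      using polar_syms[OF Ss, of ?O ?O R] S(4) by simp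
    then have "polar (weierstrass a b) ?O ?O R = 0" by (simp only: scale_right) simp
    then show False by (simp add: polar_weierstrass R_def axis_def)
  qed
  moreover have "weierstrass a b (?O - l ?O *s R) = 0"
    unfolding S(3)[symmetric] S(2) by (simp add: weierstrass_def axis_def)
  \<comment> \<open>The image O - l R lies on the curve, whose equation on this line has only the
    solutions l = 0, giving O, and l = -1/(2 y), giving the third point \<open>P\<close>.\<close>
  then have "l ?O * (1 + 2 * l ?O * y) = 0"
  proof -
    assume "weierstrass a b (?O - l ?O *s R) = 0"
    moreover have "weierstrass a b (?O - l ?O *s R) =
      (l ?O) ^ 3 * (y\<^sup>2 - (x ^ 3 + a * x + b)) + l ?O * (1 + 2 * l ?O * y)"
      unfolding R_def weierstrass_def by (simp add: axis_def) algebra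
    ultimately show ?thesis using xy(3) by simp
  qed
  ultimately have l: "2 * l ?O * y = - 1" by (simp add: eq_neg_iff_add_eq_0 add.commute)
  have "S *v ?O = (- l ?O) *s P"
    unfolding S(3) R_def xy(1) using l by (simp add: vec_eq_iff forall_3 axis_def algebra_simps)
  with \<open>l ?O \<noteq> 0\<close> show ?thesis using that[OF Ss, of "- l ?O"] by simp
qed

section \<open>The stabilizer of the flex at infinity and the orbit count\<close>

definition stabilizer :: "complex \<Rightarrow> complex \<Rightarrow> (complex ^ 3 ^ 3) set" where
  "stabilizer a b = {A \<in> syms (weierstrass a b). \<exists>k. A *v axis 2 1 = k *s axis 2 1}"

text \<open>A symmetry that fixes the flex \<open>(0 : 1 : 0)\<close> also fixes the tangent \<open>z = 0\<close> there.\<close>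

lemma stabilizer_eq:
  "stabilizer a b = (\<lambda>(w, k). diag3 w k (1 / k\<^sup>2)) `
     {(w, k). w ^ 3 = 1 \<and> k \<noteq> 0 \<and> a * w = a * k ^ 4 \<and> b = b * k ^ 6}" (is "_ = ?\<phi> ` ?S")
proof (intro equalityI subsetI)
  fix A assume "A \<in> ?\<phi> ` ?S"
  then obtain w k where wk: "w ^ 3 = 1" "k \<noteq> 0" "a * w = a * k ^ 4" "b = b * k ^ 6"
    "A = diag3 w k (1 / k\<^sup>2)" by auto
  have "w \<noteq> 0" using wk(1) by auto
  have "weierstrass a b (A *v v) = w ^ 3 * v $ 1 ^ 3 + (a * w) / k ^ 4 * v $ 1 * (v $ 3)\<^sup>2 +
      b / k ^ 6 * v $ 3 ^ 3 - (v $ 2)\<^sup>2 * v $ 3" for v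
    unfolding wk(5) weierstrass_def using wk(2)
    by (simp add: diag3_def matrix_vector_mult_nth power_mult_distrib power_divide field_simps)
  moreover have "a * w / k ^ 4 = a" "b / k ^ 6 = b"
    using wk(2-4) by (simp_all only: divide_eq_eq) simp_all
  ultimately have "weierstrass a b (A *v v) = weierstrass a b v" for v
    using wk(1) by (simp add: weierstrass_def)
  moreover have "invertible A"
    unfolding wk(5) using \<open>w \<noteq> 0\<close> wk(2) by (simp add: invertible_iff_det diag3_def det_matrix3)
  moreover have "A *v axis 2 1 = k *s axis 2 1"
    unfolding wk(5) by (simp add: diag3_def vec_eq_iff forall_3 matrix_vector_mult_nth axis_def)
  ultimately show "A \<in> stabilizer a b" by (auto simp: stabilizer_def syms_def)
next
  fix A assume "A \<in> stabilizer a b"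
  then obtain k where A: "A \<in> syms (weierstrass a b)" "A *v axis 2 1 = k *s axis 2 1"
    by (auto simp: stabilizer_def)
  interpret cubic_form "weierstrass a b" by (rule cubic_form_weierstrass)
  have "(A *v axis 2 1) $ i = (k *s axis 2 1 :: complex ^ 3) $ i" for i using A(2) by simp
  from this[of 1] this[of 2] this[of 3] have col: "A $ 1 $ 2 = 0" "A $ 2 $ 2 = k" "A $ 3 $ 2 = 0"
    by (simp_all add: matrix_vector_mult_nth axis_def)
  \<comment> \<open>The polar value at (O, O, w) is minus one third of the last coordinate of
    \<open>w\<close>, so its invariance determines the third row.\<close>
  have row: "k\<^sup>2 * (A *v w) $ 3 = w $ 3" for w
  proof -
    have "polar (weierstrass a b) (k *s axis 2 1) (k *s axis 2 1) (A *v w) =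
        polar (weierstrass a b) (axis 2 1) (axis 2 1) w"
      using polar_syms[OF A(1), of "axis 2 1" "axis 2 1" w] by (simp only: A(2))
    then show ?thesis by (simp add: polar_weierstrass axis_def power2_eq_square)
  qed
  from row[of "axis 3 1"] have k: "k\<^sup>2 * A $ 3 $ 3 = 1" "k \<noteq> 0"
    by (auto simp: matrix_vector_mult_nth axis_def)
  from row[of "axis 1 1"] k(2) have "A $ 3 $ 1 = 0"
    by (simp add: matrix_vector_mult_nth axis_def)
  define w where "w = A $ 1 $ 1"
  define p where "p = A $ 1 $ 3"
  define d where "d = A $ 2 $ 1"
  define e where "e = A $ 2 $ 3"
  define m where "m = A $ 3 $ 3"
  have km: "k\<^sup>2 * m = 1" "m = 1 / k\<^sup>2" using k by (simp_all add: m_def field_simps)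
  then have "m \<noteq> 0" by auto
  have *: "(w * x + p * z) ^ 3 + a * (w * x + p * z) * (m * z)\<^sup>2 + b * (m * z) ^ 3 -
      (d * x + k * y + e * z)\<^sup>2 * (m * z) = x ^ 3 + a * x * z\<^sup>2 + b * z ^ 3 - y\<^sup>2 * z" for x y z
  proof -
    have "weierstrass a b (A *v vector [x, y, z]) = weierstrass a b (vector [x, y, z])"
      using A(1) by (simp add: syms_def)
    then show ?thesis
      by (simp add: weierstrass_def matrix_vector_mult_nth col \<open>A $ 3 $ 1 = 0\<close> w_def p_def d_def e_def m_def)
  qed
  \<comment> \<open>The difference of the values at y = -1 and y = 1 keeps the terms odd in y, and
    the right-hand side of \<open>*\<close> has none.\<close>
  have "4 * k * m * (d * x + e) = ((w * x + p * 1) ^ 3 + a * (w * x + p * 1) * (m * 1)\<^sup>2 + b * (m * 1) ^ 3 -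
      (d * x + k * (- 1) + e * 1)\<^sup>2 * (m * 1)) - ((w * x + p * 1) ^ 3 + a * (w * x + p * 1) * (m * 1)\<^sup>2 + b * (m * 1) ^ 3 -
      (d * x + k * 1 + e * 1)\<^sup>2 * (m * 1))" for x
    by algebra
  then have "d * x + e = 0" for x unfolding * using k(2) \<open>m \<noteq> 0\<close> by simp
  from this[of 0] this[of 1] have de: "d = 0" "e = 0" by auto
  have w3: "w ^ 3 = 1" using *[of 1 0 0] by simp
  have **: "(w * x + p) ^ 3 + a * (w * x + p) * m\<^sup>2 + b * m ^ 3 = x ^ 3 + a * x + b" for x
    using *[where x = x and y = 0 and z = 1] de by simp
  \<comment> \<open>The second difference over -1, 0, 1 isolates the coefficient of x^2.\<close>
  have "6 * (w\<^sup>2 * p) = ((w * 1 + p) ^ 3 + a * (w * 1 + p) * m\<^sup>2 + b * m ^ 3) +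
      ((w * (- 1) + p) ^ 3 + a * (w * (- 1) + p) * m\<^sup>2 + b * m ^ 3) -
      2 * ((w * 0 + p) ^ 3 + a * (w * 0 + p) * m\<^sup>2 + b * m ^ 3)"
    by algebra
  also have "\<dots> = 0" unfolding ** by simp
  finally have "p = 0" using w3 by auto
  have bm: "b * m ^ 3 = b" using **[of 0] \<open>p = 0\<close> by simp
  have am: "a * w * m\<^sup>2 = a" using **[of 1] \<open>p = 0\<close> w3 bm by simp
  have "b * k ^ 6 = (b * m ^ 3) * k ^ 6" using bm by simp
  also have "\<dots> = b * (k\<^sup>2 * m) ^ 3" by algebra
  finally have "b = b * k ^ 6" using km by simp
  have "a * k ^ 4 = (a * w * m\<^sup>2) * k ^ 4" using am by simp
  also have "\<dots> = a * w * (k\<^sup>2 * m)\<^sup>2" by algebra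
  finally have "a * w = a * k ^ 4" using km(1) by auto
  have "A = diag3 w k (1 / k\<^sup>2)"
    by (rule matrix3_eqI)
      (simp_all add: diag3_def col \<open>A $ 3 $ 1 = 0\<close> de[unfolded d_def e_def] \<open>p = 0\<close>[unfolded p_def] km(2)[unfolded m_def] w_def)
  then show "A \<in> ?\<phi> ` ?S"
    using w3 k(2) \<open>b = b * k ^ 6\<close> \<open>a * w = a * k ^ 4\<close> by (intro image_eqI[of _ _ "(w, k)"]) auto
qed

text \<open>The factors \<open>a\<close> and \<open>b\<close> stay in the conditions: when one of
  them is 0 its condition disappears and the stabilizer grows, which separates the three smooth
  cases.\<close>

lemma card_stabilizer:
  "card (stabilizer a b) = card {(w, k). w ^ 3 = 1 \<and> k \<noteq> 0 \<and> a * w = a * k ^ 4 \<and> b = b * k ^ 6}"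
proof -
  have "inj (\<lambda>(w, k). diag3 w k (1 / k\<^sup>2))"
  proof (rule injI, clarify)
    fix w k w' k' assume *: "diag3 w k (1 / k\<^sup>2) = diag3 w' k' (1 / k'\<^sup>2)"
    have "diag3 w k (1 / k\<^sup>2) $ i $ j = diag3 w' k' (1 / k'\<^sup>2) $ i $ j" for i j using * by simp
    from this[of 1 1] this[of 2 2] show "w = w' \<and> k = k'" by (simp add: diag3_def)
  qed
  then show ?thesis
    unfolding stabilizer_eq by (intro card_image) (rule inj_on_subset[OF _ subset_UNIV])
qed

text \<open>Orbit counting: with a chosen symmetry \<open>T P\<close> taking O to each flex
  \<open>P\<close>, every symmetry is uniquely \<open>T P ** A\<close> with \<open>A\<close> in the
  stabilizer. Flexes are reached only up to scalars, hence the factors \<open>c\<close>,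
  \<open>k\<close>, \<open>l\<close>.\<close>

lemma card_syms_weierstrass:
  assumes sm: "smooth_cubic (weierstrass a b)"
  shows "card (syms (weierstrass a b)) = 9 * card (stabilizer a b)"
proof -
  let ?f = "weierstrass a b" and ?O = "axis 2 1 :: complex ^ 3"
  have "\<exists>S c. S \<in> syms ?f \<and> c \<noteq> 0 \<and> S *v ?O = c *s P" if "P \<in> flex_points a b" for P
    using syms_transitive[OF sm that] by metis
  then obtain T c where T: "\<And>P. P \<in> flex_points a b \<Longrightarrow> T P \<in> syms ?f"
    "\<And>P. P \<in> flex_points a b \<Longrightarrow> c P \<noteq> 0" "\<And>P. P \<in> flex_points a b \<Longrightarrow> T P *v ?O = c P *s P"
    by metis
  have k: "\<exists>k. k \<noteq> 0 \<and> A *v ?O = k *s ?O" if A: "A \<in> stabilizer a b" for A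
  proof -
    obtain k where k: "A *v ?O = k *s ?O" "invertible A" using A by (auto simp: stabilizer_def syms_def)
    have "A *v ?O \<noteq> 0" using k(2) invertible_mult_eq_0 by (metis axis_eq_0_iff one_neq_zero)
    then have "k \<noteq> 0" using k(1) by auto
    with k show ?thesis by blast
  qed
  have "bij_betw (\<lambda>(P, A). T P ** A) (flex_points a b \<times> stabilizer a b) (syms ?f)"
    unfolding bij_betw_def
  proof (intro conjI equalityI subsetI)
    show "inj_on (\<lambda>(P, A). T P ** A) (flex_points a b \<times> stabilizer a b)"
    proof (rule inj_onI, clarify)
      fix P A Q B
      assume PQ: "P \<in> flex_points a b" "Q \<in> flex_points a b"
        and AB: "A \<in> stabilizer a b" "B \<in> stabilizer a b" "T P ** A = T Q ** B"
      obtain k l where kl: "k \<noteq> 0" "A *v ?O = k *s ?O" "l \<noteq> 0" "B *v ?O = l *s ?O"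
        using k AB(1,2) by metis
      have "T P *v (A *v ?O) = T Q *v (B *v ?O)" using AB(3) by (simp add: matrix_vector_mul_assoc)
      then have eq: "(k * c P) *s P = (l * c Q) *s Q"
        using T PQ kl by (simp add: vector_scalar_commute vector_smult_assoc)
      have "P = (1 / (k * c P)) *s ((k * c P) *s P)"
        using kl T(2)[OF PQ(1)] by (simp add: vector_smult_assoc)
      also have "\<dots> = ((l * c Q) / (k * c P)) *s Q" unfolding eq by (simp add: vector_smult_assoc)
      finally have "P = Q" using flex_points_eq_if_proportional PQ by blast
      moreover have "invertible (T P)" using T(1) PQ(1) by (auto simp: syms_def)
      ultimately have "A = B"
        using AB(3) by (metis matrix_inv(2) matrix_mul_assoc matrix_mul_lid)
      then show "P = Q \<and> A = B" using \<open>P = Q\<close> by simp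
    qed
  next
    fix X assume "X \<in> (\<lambda>(P, A). T P ** A) ` (flex_points a b \<times> stabilizer a b)"
    then show "X \<in> syms ?f" using T(1) by (auto simp: stabilizer_def intro: syms_mult)
  next
    fix X assume X: "X \<in> syms ?f"
    then have "is_flex ?f (X *v ?O)" using is_flex_syms is_flex_weierstrass_infinity by blast
    then obtain l P where P: "l \<noteq> 0" "P \<in> flex_points a b" "X *v ?O = l *s P"
      by (rule flex_proportional_flex_points)
    have inv: "invertible (T P)" using T(1)[OF P(2)] by (simp add: syms_def)
    let ?A = "matrix_inv (T P) ** X"
    have "?A *v ?O = (l / c P) *s (matrix_inv (T P) *v (c P *s P))"
      using T(2)[OF P(2)] P(3)
      by (simp add: matrix_vector_mul_assoc[symmetric] vector_scalar_commute vector_smult_assoc)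
    also have "\<dots> = (l / c P) *s ?O" using T(3)[OF P(2)] matrix_inv_vector(2)[OF inv] by metis
    finally have "?A *v ?O = (l / c P) *s ?O" .
    then have "?A \<in> stabilizer a b"
      unfolding stabilizer_def using syms_mult[OF syms_inverse[OF T(1)[OF P(2)]] X] by blast
    moreover have "T P ** ?A = X" by (simp add: matrix_mul_assoc matrix_inv inv)
    ultimately show "X \<in> (\<lambda>(P, A). T P ** A) ` (flex_points a b \<times> stabilizer a b)"
      using P(2) by (intro image_eqI[of _ _ "(P, ?A)"]) auto
  qed
  then have "card (syms ?f) = card (flex_points a b \<times> stabilizer a b)"
    by (metis bij_betw_same_card)
  then show ?thesis by (simp add: card_cartesian_product card_flex_points[OF sm])
qed

text \<open>Here w = k^4 and k^6 = 1, which already implies w^3 = 1.\<close>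

lemma card_stabilizer_general:
  assumes "a \<noteq> 0" "b \<noteq> 0"
  shows "card (stabilizer a b) = 6"
proof -
  have "{(w, k). w ^ 3 = 1 \<and> k \<noteq> 0 \<and> a * w = a * k ^ 4 \<and> b = b * k ^ 6} = (\<lambda>k. (k ^ 4, k)) ` {k :: complex. k ^ 6 = 1}"
  proof -
    have "(k ^ 4) ^ 3 = 1" if "k ^ 6 = 1" for k :: complex
      using that power_mult[of k 6 2] power_mult[of k 4 3] by simp
    then show ?thesis using assms by auto
  qed
  moreover have "inj (\<lambda>k :: complex. (k ^ 4, k))" by (auto simp: inj_def)
  ultimately show ?thesis
    unfolding card_stabilizer by (simp add: card_image inj_on_subset card_roots_unity_eq)
qed

text \<open>Here w = k^4, and the only remaining condition w^3 = 1 reads k^12 = 1.\<close>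

lemma card_stabilizer_harmonic:
  assumes "a \<noteq> 0"
  shows "card (stabilizer a 0) = 12"
proof -
  have "{(w, k). w ^ 3 = 1 \<and> k \<noteq> 0 \<and> a * w = a * k ^ 4 \<and> 0 = 0 * k ^ 6} = (\<lambda>k. (k ^ 4, k)) ` {k :: complex. k ^ 12 = 1}"
  proof -
    have "(k ^ 4) ^ 3 = k ^ 12" for k :: complex by (simp flip: power_mult)
    then show ?thesis using assms by (auto simp: image_iff)
  qed
  moreover have "inj (\<lambda>k :: complex. (k ^ 4, k))" by (auto simp: inj_def)
  ultimately show ?thesis
    unfolding card_stabilizer by (simp add: card_image inj_on_subset card_roots_unity_eq)
qed

text \<open>Here w and k are independent, with w^3 = 1 and k^6 = 1.\<close>

lemma card_stabilizer_equianharmonic: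
  assumes "b \<noteq> 0"
  shows "card (stabilizer 0 b) = 18"
proof -
  have "{(w, k). w ^ 3 = 1 \<and> k \<noteq> 0 \<and> 0 * w = 0 * k ^ 4 \<and> b = b * k ^ 6} =
      {w :: complex. w ^ 3 = 1} \<times> {k :: complex. k ^ 6 = 1}"
    using assms by auto
  then show ?thesis
    unfolding card_stabilizer by (simp add: card_cartesian_product card_roots_unity_eq)
qed

section \<open>The canonical forms\<close>

lemma eval3_canonical:
  "eval3 (homogenize (p_var ^ 3 - q_var ^ 2)) = cusp"
  "eval3 (homogenize (p_var ^ 2 * (p_var + 1) - q_var ^ 2)) = (\<lambda>v. (v $ 1)\<^sup>2 * (v $ 1 + v $ 3) - (v $ 2)\<^sup>2 * v $ 3)"
  "eval3 (homogenize (p_var ^ 3 + cst a * p_var + 1 - q_var ^ 2)) = weierstrass a 1"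
  "eval3 (homogenize (p_var ^ 3 + p_var - q_var ^ 2)) = weierstrass 1 0"
  "eval3 (homogenize (p_var ^ 3 + 1 - q_var ^ 2)) = weierstrass 0 1"
  by (simp_all add: fun_eq_iff cusp_def weierstrass_def eval3_cusp eval3_node eval3_family eval3_harmonic
      eval3_equianharmonic)

text \<open>Scale z by t and y by a square root of 1/t, which preserves y^2 z.\<close>

lemma weierstrass_scale:
  assumes "t \<noteq> 0"
  shows "lin_equiv (weierstrass a b) (weierstrass (a * t\<^sup>2) (b * t ^ 3))"
proof -
  obtain r where r: "r\<^sup>2 = 1 / t" using exists_complex_root[of 2] by (metis zero_neq_numeral)
  then have "r \<noteq> 0" using assms by auto
  show ?thesis
    by (rule lin_equiv_matrix3[of _ _ 1 0 0 0 r 0 0 0 t])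
      (use r assms \<open>r \<noteq> 0\<close> in \<open>simp_all add: weierstrass_def matrix_vector_mult_nth power_mult_distrib\<close>)
qed

lemma (in smooth_cubic) smooth_classification:
  "(\<exists>a. a \<noteq> 0 \<and> lin_equiv f (weierstrass a 1)) \<or> lin_equiv f (weierstrass 1 0) \<or> lin_equiv f (weierstrass 0 1)"
proof -
  obtain P where "is_flex f P" by (rule flex_exists)
  then obtain B :: "complex ^ 3 ^ 3" and a b where "invertible B" "\<And>v. f (B *v v) = weierstrass a b v"
    by (rule flex_weierstrass) (rule that)
  then have f: "lin_equiv f (weierstrass a b)" unfolding lin_equiv_def by metis
  then have sm: "smooth_cubic (weierstrass a b)" using smooth_cubic_lin_equiv smooth_cubic_axioms by blast
  \<comment> \<open>For a = b = 0 the form is the cusp, singular at (0 : 0 : 1).\<close>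
  have "a \<noteq> 0 \<or> b \<noteq> 0"
  proof (rule ccontr)
    assume "\<not> (a \<noteq> 0 \<or> b \<noteq> 0)"
    then have "polar (weierstrass a b) (axis 3 1) (axis 3 1) w = 0" for w
      by (simp add: polar_weierstrass axis_def)
    then have "axis 3 1 = (0 :: complex ^ 3)" using smooth_cubic.smooth[OF sm] by blast
    then show False by (simp add: axis_eq_0_iff)
  qed
  then consider "b \<noteq> 0" | "b = 0" "a \<noteq> 0" by auto
  then show ?thesis
  proof cases
    case 1
    obtain t where t: "t ^ 3 = 1 / b" using exists_complex_root[of 3] by (metis zero_neq_numeral)
    then have "t \<noteq> 0" using 1 by auto
    then have "lin_equiv f (weierstrass (a * t\<^sup>2) 1)"
      using lin_equiv_trans[OF f weierstrass_scale[of t a b]] t 1 by simp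
    then obtain c where "lin_equiv f (weierstrass c 1)" by blast
    then show ?thesis by (cases "c = 0") auto
  next
    case 2
    obtain t where t: "t\<^sup>2 = 1 / a" using exists_complex_root[of 2] by (metis zero_neq_numeral)
    then have "t \<noteq> 0" using 2 by auto
    then have "lin_equiv f (weierstrass 1 0)"
      using lin_equiv_trans[OF f weierstrass_scale[of t a b]] t 2 by simp
    then show ?thesis by blast
  qed
qed

lemma card_syms_smooth:
  assumes "smooth_cubic f" "lin_equiv f (weierstrass a b)"
  shows "card (syms f) = 9 * card (stabilizer a b)"
  using card_syms_lin_equiv(1)[OF assms(2)] card_syms_weierstrass[OF smooth_cubic_lin_equiv[OF assms]] by simp

lemma mat_mult_conjugate:
  fixes A B C :: "complex ^ 3 ^ 3"
  shows "mat c ** (A ** B ** C) = A ** (mat c ** B) ** C"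
proof -
  have "mat c ** A = A ** mat c"
    by (simp add: vec_eq_iff mat_mult_entry mult_mat_entry mult.commute)
  then show ?thesis by (metis matrix_mul_assoc)
qed

text \<open>The (1, 1) entry of \<open>cusp_matrix\<close> is 1, so proportional members of the
  family are equal and \<alpha> parametrizes the projective symmetries faithfully. This is the
  precise form of one-dimensionality.\<close>

lemma cusp_symmetries:
  fixes A :: "complex ^ 3 ^ 3"
  assumes "invertible A" "\<And>v. cusp v = f (A *v v)"
  shows "syms f = {mat \<omega> ** (A ** cusp_matrix \<alpha> ** matrix_inv A) | \<omega> \<alpha>. \<omega> ^ 3 = 1 \<and> \<alpha> \<noteq> 0}"
    and "bij_betw (\<lambda>\<alpha>. proj_class (A ** cusp_matrix \<alpha> ** matrix_inv A)) (- {0}) (proj_class ` syms f)"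
proof -
  show s: "syms f = {mat \<omega> ** (A ** cusp_matrix \<alpha> ** matrix_inv A) | \<omega> \<alpha>. \<omega> ^ 3 = 1 \<and> \<alpha> \<noteq> 0}"
    unfolding syms_conjugate[of A cusp f, OF assms] syms_cusp mat_mult_conjugate by blast
  let ?h = "\<lambda>\<alpha>. proj_class (A ** cusp_matrix \<alpha> ** matrix_inv A)"
  have "inj_on ?h (- {0})"
  proof (rule inj_onI)
    fix \<alpha> \<beta> assume "?h \<alpha> = ?h \<beta>"
    then obtain c where "A ** cusp_matrix \<alpha> ** matrix_inv A = A ** (mat c ** cusp_matrix \<beta>) ** matrix_inv A"
      unfolding proj_class_eq_iff mat_mult_conjugate by blast
    then have "cusp_matrix \<alpha> = mat c ** cusp_matrix \<beta>"
      using conjugate_cancel(1)[OF assms(1)] by metis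
    then have "cusp_matrix \<alpha> $ i $ j = c * cusp_matrix \<beta> $ i $ j" for i j by (simp add: mat_mult_entry)
    from this[of 1 1] this[of 2 2] show "\<alpha> = \<beta>" by (simp add: cusp_matrix_def)
  qed
  moreover have "?h ` (- {0}) = proj_class ` syms f"
  proof -
    have *: "proj_class (mat \<omega> ** B) = proj_class B" if "\<omega> ^ 3 = 1" for \<omega> B
      using that unfolding proj_class_eq_iff by (intro exI[of _ \<omega>]) auto
    show ?thesis
    proof (intro equalityI subsetI)
      fix y assume "y \<in> ?h ` (- {0})"
      then obtain \<alpha> where "\<alpha> \<noteq> 0" "y = ?h \<alpha>" by auto
      moreover have "mat 1 ** (A ** cusp_matrix \<alpha> ** matrix_inv A) \<in> syms f"
        unfolding s using \<open>\<alpha> \<noteq> 0\<close> power_one by blast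
      ultimately show "y \<in> proj_class ` syms f" by simp
    qed (use * in \<open>auto simp: s\<close>)
  qed
  ultimately show "bij_betw ?h (- {0}) (proj_class ` syms f)" by (simp add: bij_betw_def)
qed

lemma degree_1_pCons:
  assumes "degree p = 1"
  obtains a b where "p = [:a, b:]" "b \<noteq> 0"
proof (cases p rule: pCons_cases)
  case (pCons a q)
  then have "degree q = 0" "q \<noteq> 0" using assms by (auto split: if_splits)
  then show ?thesis using that pCons by (auto elim: degree_eq_zeroE)
qed

section \<open>The Fermat cubic\<close>

abbreviation (input) "fermat \<equiv> homogenize (p_var ^ 3 + q_var ^ 3 + 1)"

lemma fermat_pCons: "fermat = [: [: [:0, 0, 0, 1:], 0, 0, 1:], 0, 0, 1:]"
  by (rule eval3_inject, rule ext, unfold eval3_fermat)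
    (simp add: eval3_def power3_eq_cube algebra_simps)

text \<open>A cube root of -(y^3 + z^3) would be r0 + r1 y with r1 nonzero; the missing y term
  forces r0 = 0, against the term z^3.\<close>

lemma no_cube_root_fermat:
  fixes r :: "complex poly poly"
  shows "r ^ 3 \<noteq> - [: [:0, 0, 0, 1:], 0, 0, 1:]"
proof
  assume r: "r ^ 3 = - [: [:0, 0, 0, 1:], 0, 0, 1:]"
  then have "degree (r ^ 3) = 3" by simp
  then have "degree r = 1" by (cases "r = 0") (simp_all add: degree_power_eq)
  then obtain r0 r1 where rr: "r = [:r0, r1:]" "r1 \<noteq> 0" by (rule degree_1_pCons)
  have "coeff (r ^ 3) 0 = - [:0, 0, 0, 1:]" "coeff (r ^ 3) 1 = 0" unfolding r by simp_all
  then have "r0 ^ 3 = - [:0, 0, 0, 1:]" "3 * r0\<^sup>2 * r1 = 0"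
    by (simp_all add: rr power3_eq_cube power2_eq_square algebra_simps)
  then show False using rr(2) by auto
qed

text \<open>The cubic is monic in x, so one of two factors has degree at most 1 in x and a leading
  coefficient that is a unit. Degree 1 would give a root, a cube root of -(y^3 + z^3); degree 0
  gives a unit.\<close>

lemma irreducible_fermat: "irreducible fermat"
proof -
  let ?c = "[: [:0, 0, 0, 1:], 0, 0, 1:] :: complex poly poly"
  let ?F = "[: ?c, 0, 0, 1:]"
  have unit: "is_unit a" if ab: "?F = a * b" "degree a \<le> 1" for a b
  proof -
    have "lead_coeff a * lead_coeff b = lead_coeff ?F" unfolding ab by (simp add: lead_coeff_mult)
    then have u: "lead_coeff a * lead_coeff b = 1" by simp
    have "degree a \<noteq> 1"
    proof
      assume "degree a = 1"
      then obtain v w where a: "a = [:v, w:]" "w \<noteq> 0" by (rule degree_1_pCons)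
      \<comment> \<open>The inverse of the leading coefficient of \<open>a\<close> is that of
        \<open>b\<close>, so this is the root of \<open>a\<close>.\<close>
      have "poly a (- v * lead_coeff b) = v - v * (lead_coeff a * lead_coeff b)"
        using a by (simp add: algebra_simps)
      then have "poly ?F (- v * lead_coeff b) = 0" unfolding ab u by simp
      then have "(- v * lead_coeff b) ^ 3 = - ?c"
        by (simp add: power3_eq_cube eq_neg_iff_add_eq_0 algebra_simps)
      then show False using no_cube_root_fermat by blast
    qed
    with ab(2) have "degree a = 0" by simp
    then obtain w where "a = [:w:]" by (metis degree_eq_zeroE)
    with u have "is_unit w" by (auto intro: dvdI)
    then show ?thesis unfolding \<open>a = [:w:]\<close> by (simp add: is_unit_const_poly_iff)
  qed
  show ?thesis
    unfolding fermat_pCons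
  proof (rule irreducibleI)
    show "\<not> is_unit ?F"
    proof
      assume "is_unit ?F"
      then obtain c where "?F = [:c:]" using is_unit_poly_iff by blast
      then show False by simp
    qed
    fix a b assume ab: "?F = a * b"
    have "a \<noteq> 0" "b \<noteq> 0" using ab by auto
    then have "degree a + degree b = degree ?F" unfolding ab by (simp add: degree_mult_eq)
    then have "degree a + degree b = 3" by simp
    then have "degree a \<le> 1 \<or> degree b \<le> 1" by linarith
    then show "is_unit a \<or> is_unit b" using unit ab by (metis mult.commute)
  qed simp
qed

lemma smooth_fermat: "\<not> singular_curve fermat"
proof -
  have e: "eval3 fermat = (\<lambda>v. v $ 1 * v $ 1 * v $ 1 + v $ 2 * v $ 2 * v $ 2 + v $ 3 * v $ 3 * v $ 3)"
    by (rule ext, unfold eval3_fermat) (simp only: power3_eq_cube)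
  have "polar (eval3 fermat) v v w = (v $ 1)\<^sup>2 * w $ 1 + (v $ 2)\<^sup>2 * w $ 2 + (v $ 3)\<^sup>2 * w $ 3" for v w
    unfolding e polar_add polar_monomial by (simp add: field_simps power2_eq_square)
  moreover have "v = 0" if "\<forall>w :: complex ^ 3. (v $ 1)\<^sup>2 * w $ 1 + (v $ 2)\<^sup>2 * w $ 2 + (v $ 3)\<^sup>2 * w $ 3 = 0" for v :: "complex ^ 3"
    using that[rule_format, of "axis 1 1"] that[rule_format, of "axis 2 1"] that[rule_format, of "axis 3 1"]
    by (simp add: axis_def vec_eq_iff forall_3)
  ultimately show ?thesis
    unfolding singular_curve_iff[OF homogeneous_cubic_homogenize] by auto
qed

text \<open>The cubes of s z + t y and s z - t y add up to 2 s^3 z^3 + 6 s t^2 y^2 z, and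
  \<open>s\<close>, \<open>t\<close> are chosen to make the coefficients 1 and -1.\<close>

lemma fermat_lin_equiv: "lin_equiv (eval3 fermat) (weierstrass 0 1)"
proof -
  obtain s :: complex where s: "s ^ 3 = 1 / 2" using exists_complex_root[of 3] by (metis zero_neq_numeral)
  then have "s \<noteq> 0" by auto
  obtain t where t: "t\<^sup>2 = - 1 / (6 * s)" using exists_complex_root[of 2] by (metis zero_neq_numeral)
  then have "t \<noteq> 0" using \<open>s \<noteq> 0\<close> by auto
  show ?thesis
  proof (rule lin_equiv_matrix3[of _ _ 1 0 0 0 t s 0 "- t" s])
    fix v
    have "eval3 fermat (matrix3 1 0 0 0 t s 0 (- t) s *v v) =
        v $ 1 ^ 3 + 2 * s ^ 3 * v $ 3 ^ 3 + 6 * s * t\<^sup>2 * (v $ 2)\<^sup>2 * v $ 3"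
      unfolding eval3_fermat matrix_vector_mult_nth matrix3_nth by algebra
    also have "\<dots> = weierstrass 0 1 v"
      using \<open>s \<noteq> 0\<close> by (simp add: s t weierstrass_def)
    finally show "weierstrass 0 1 v = eval3 fermat (matrix3 1 0 0 0 t s 0 (- t) s *v v)" by simp
  qed (use \<open>s \<noteq> 0\<close> \<open>t \<noteq> 0\<close> in simp)
qed

lemma finite_imp_discrete:
  fixes S :: "'a :: t1_space set"
  shows "finite S \<Longrightarrow> discrete S"
  unfolding discrete_def isolated_in_islimpt_iff using islimpt_finite by blast

theorem theorem3p4p2:
  fixes F :: "complex poly poly poly"
  assumes "homogeneous_cubic F"
    and "irreducible F"
  shows
    "(singular_curve F \<longrightarrow>
        (equivalent F (homogenize (p_var ^ 3 - q_var ^ 2)) \<or>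
         equivalent F (homogenize (p_var ^ 2 * (p_var + 1) - q_var ^ 2))) \<and>
        (\<forall>A. transforms_to F A (homogenize (p_var ^ 3 - q_var ^ 2)) \<longrightarrow>
           symmetry_group F =
             {mat \<omega> ** (A ** cusp_matrix \<alpha> ** matrix_inv A) | \<omega> \<alpha>. \<omega> ^ 3 = 1 \<and> \<alpha> \<noteq> 0} \<and>
           bij_betw (\<lambda>\<alpha>. proj_class (A ** cusp_matrix \<alpha> ** matrix_inv A))
             (- {0}) (projective_symmetry_group F)) \<and>
        (equivalent F (homogenize (p_var ^ 2 * (p_var + 1) - q_var ^ 2)) \<longrightarrow>
           discrete (symmetry_group F) \<and>
           card (projective_symmetry_group F) = 6 \<and>
           card (symmetry_group F) = 18))
     \<and>
     (\<not> singular_curve F \<longrightarrow>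
        ((\<exists>a. a \<noteq> 0 \<and> equivalent F (homogenize (p_var ^ 3 + cst a * p_var + 1 - q_var ^ 2))) \<or>
         equivalent F (homogenize (p_var ^ 3 + p_var - q_var ^ 2)) \<or>
         equivalent F (homogenize (p_var ^ 3 + 1 - q_var ^ 2))) \<and>
        (\<forall>a. a \<noteq> 0 \<and> equivalent F (homogenize (p_var ^ 3 + cst a * p_var + 1 - q_var ^ 2)) \<longrightarrow>
           card (projective_symmetry_group F) = 18) \<and>
        (equivalent F (homogenize (p_var ^ 3 + p_var - q_var ^ 2)) \<longrightarrow>
           card (projective_symmetry_group F) = 36) \<and>
        (equivalent F (homogenize (p_var ^ 3 + 1 - q_var ^ 2)) \<longrightarrow>
           card (projective_symmetry_group F) = 54))
     \<and>
     (irreducible (homogenize (p_var ^ 3 + q_var ^ 3 + 1)) \<and>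
      \<not> singular_curve (homogenize (p_var ^ 3 + q_var ^ 3 + 1)) \<and>
      equivalent (homogenize (p_var ^ 3 + q_var ^ 3 + 1)) (homogenize (p_var ^ 3 + 1 - q_var ^ 2)))"
proof -
  let ?f = "eval3 F"
  have cubic: "cubic_form ?f" by (rule cubic_form_eval3[OF assms(1)])
  have nf: "\<not> has_factor ?f" by (rule irreducible_not_has_factor[OF assms(2)])
  \<comment> \<open>A nonzero value of the cubic is what restricts the scalars preserving it to cube
    roots of unity.\<close>
  have "F \<noteq> 0" using assms(2) by auto
  then have "?f \<noteq> eval3 0" using eval3_inject by blast
  then obtain e where e: "?f e \<noteq> 0" by (auto simp: fun_eq_iff)
  \<comment> \<open>Positive cardinality expresses finiteness, since infinite sets have
    \<open>card\<close> 0.\<close>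
  have proj: "card (symmetry_group F) = 3 * card (projective_symmetry_group F)"
    if "card (symmetry_group F) > 0"
    using that card_syms_projective[OF cubic e] card_ge_0_finite
    unfolding projective_symmetry_group_def symmetry_group_eq_syms by blast
  note defs = equivalent_iff_lin_equiv eval3_canonical
  have node: "finite (symmetry_group F)" "card (symmetry_group F) = 18"
    if "equivalent F (homogenize (p_var ^ 2 * (p_var + 1) - q_var ^ 2))"
  proof -
    have "lin_equiv ?f (\<lambda>v. (v $ 1)\<^sup>2 * (v $ 1 + v $ 3) - (v $ 2)\<^sup>2 * v $ 3)"
      using that unfolding defs .
    from card_syms_lin_equiv[OF this] show "finite (symmetry_group F)" "card (symmetry_group F) = 18"
      using card_syms_lin_equiv[OF lin_equiv_node] card_syms_node
      unfolding symmetry_group_eq_syms by simp_all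
  qed
  have node_proj: "discrete (symmetry_group F)" "card (projective_symmetry_group F) = 6"
    if "equivalent F (homogenize (p_var ^ 2 * (p_var + 1) - q_var ^ 2))"
    using node[OF that] proj finite_imp_discrete by auto
  have singular: "equivalent F (homogenize (p_var ^ 3 - q_var ^ 2)) \<or>
         equivalent F (homogenize (p_var ^ 2 * (p_var + 1) - q_var ^ 2))" if "singular_curve F"
  proof -
    obtain S where "S \<noteq> 0" "\<And>w. polar ?f S S w = 0"
      using \<open>singular_curve F\<close> unfolding singular_curve_iff[OF assms(1)] by blast
    from singular_classification[OF cubic nf this]
    consider "lin_equiv ?f cusp" | "lin_equiv ?f node" unfolding cusp_def[abs_def] by blast
    then show ?thesis
    proof cases
      case 1
      then show ?thesis unfolding defs by (rule disjI1)
    next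
      case 2
      from lin_equiv_trans[OF 2 lin_equiv_node] show ?thesis unfolding defs by (rule disjI2)
    qed
  qed
  have cuspidal: "symmetry_group F =
             {mat \<omega> ** (A ** cusp_matrix \<alpha> ** matrix_inv A) | \<omega> \<alpha>. \<omega> ^ 3 = 1 \<and> \<alpha> \<noteq> 0}"
           "bij_betw (\<lambda>\<alpha>. proj_class (A ** cusp_matrix \<alpha> ** matrix_inv A))
             (- {0}) (projective_symmetry_group F)"
    if "transforms_to F A (homogenize (p_var ^ 3 - q_var ^ 2))" for A
    using that cusp_symmetries[of A ?f]
    unfolding transforms_to_def eval3_canonical symmetry_group_eq_syms projective_symmetry_group_def by simp_all
  have smooth: "(\<exists>a. a \<noteq> 0 \<and> equivalent F (homogenize (p_var ^ 3 + cst a * p_var + 1 - q_var ^ 2))) \<or>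
         equivalent F (homogenize (p_var ^ 3 + p_var - q_var ^ 2)) \<or>
         equivalent F (homogenize (p_var ^ 3 + 1 - q_var ^ 2))" if "\<not> singular_curve F"
    unfolding defs
    by (rule smooth_cubic.smooth_classification) (simp add: smooth_cubic_iff[OF assms(1)] that)
  have card: "card (symmetry_group F) = 9 * card (stabilizer a b)"
    if "\<not> singular_curve F" "lin_equiv ?f (weierstrass a b)" for a b
    unfolding symmetry_group_eq_syms
    by (rule card_syms_smooth[OF _ that(2)]) (simp add: smooth_cubic_iff[OF assms(1)] that(1))
  have card18: "card (projective_symmetry_group F) = 18" if "\<not> singular_curve F"
    "a \<noteq> 0 \<and> equivalent F (homogenize (p_var ^ 3 + cst a * p_var + 1 - q_var ^ 2))" for a
    using card[of a 1] that proj card_stabilizer_general[of a 1] unfolding defs by simp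
  have card36: "card (projective_symmetry_group F) = 36"
    if "\<not> singular_curve F" "equivalent F (homogenize (p_var ^ 3 + p_var - q_var ^ 2))"
    using card[of 1 0] that proj card_stabilizer_harmonic[of 1] unfolding defs by simp
  have card54: "card (projective_symmetry_group F) = 54"
    if "\<not> singular_curve F" "equivalent F (homogenize (p_var ^ 3 + 1 - q_var ^ 2))"
    using card[of 0 1] that proj card_stabilizer_equianharmonic[of 1] unfolding defs by simp
  have fermat: "equivalent fermat (homogenize (p_var ^ 3 + 1 - q_var ^ 2))"
    unfolding defs by (rule fermat_lin_equiv)
  show ?thesis
    by (intro conjI impI allI;
        rule singular cuspidal node_proj node(2) smooth card18 card36 card54 irreducible_fermat smooth_fermat fermat;
        assumption)
qed

end
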